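(* Let $\mathcal A$ be a category, let $S\subseteq\mathsf{Mor}(\mathcal A)$ be a class of morphisms containing all identity morphisms, let $Q:\mathcal A\to\mathcal A[S^{-1}]$ be the localization, and let $I$ be a (small) set. Suppose that $$N=\sup\{\ell(\mathfrak P)\mid\mathfrak P\in\langle\mathsf{Mor}(\mathcal A)\sqcup\overline S\rangle\}<\infty$$ and $$\sup\{\delta(\mathfrak P,\mathfrak Q)\mid[\mathfrak P]=[\mathfrak Q],\ \mathfrak P,\mathfrak Q\in\langle\mathsf{Mor}(\mathcal A)\sqcup\overline S\rangle,\ |\mathfrak P|,|\mathfrak Q|\leq N+1\}<\infty.$$ Then: (1) if $\mathcal A$ has $I$-indexed coproducts and $S$ is closed under $I$-indexed coproducts, then $\mathcal A[S^{-1}]$ also has $I$-indexed coproducts and $Q$ preserves them; (2) if $\mathcal A$ has $I$-indexed products and $S$ is closed under $I$-indexed products, then $\mathcal A[S^{-1}]$ also has $I$-indexed products and $Q$ preserves them.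
   Context: Size issues are ignored (or handled by universes); localizations always exist. The Gabriel--Zisman localization $Q:\mathcal A\to\mathcal A[S^{-1}]$ sends every morphism of $S$ to an isomorphism, and every functor out of $\mathcal A$ sending $S$ to isomorphisms factors uniquely (on the nose) through $Q$. Explicit model. Regard the morphisms of $\mathcal A$ as mere arrows with source and target. Let $\overline S=\{\overline s:Y\to X\mid (s:X\to Y)\in S\}$ be a class of new formal arrows. $\langle\mathsf{Mor}(\mathcal A)\sqcup\overline S\rangle$ is the class of all finite formal compositions (nonempty words $a_m\ast\cdots\ast a_1$ of composable arrows) of arrows in the disjoint union $\mathsf{Mor}(\mathcal A)\sqcup\overline S$; $\ast$ denotes formal composition. For such a word $\mathfrak P$, $|\mathfrak P|$ is its number of arrows. An elementary rewriting is one of the following replacements, in either direction, where $f:X\to Y$, $g:Y\to Z$ are in $\mathsf{Mor}(\mathcal A)$, $a:M\to N$ is in $\mathsf{Mor}(\mathcal A)\sqcup\overline S$, $s:X\to Y$ is in $S$, and $\mathfrak U,\mathfrak V$ are words (either or both possibly omitted) for which the expressions are defined: (i) $\mathfrak U\ast(g\ast f)\ast\mathfrak V\leftrightarrow\mathfrak U\ast(g\circ f)\ast\mathfrak V$; (ii) $\mathfrak U\ast(\operatorname{Id}_N\ast a)\ast\mathfrak V\leftrightarrow\mathfrak U\ast a\ast\mathfrak V$; (iii) $\mathfrak U\ast(a\ast\operatorname{Id}_M)\ast\mathfrak V\leftrightarrow\mathfrak U\ast a\ast\mathfrak V$; (iv) $\mathfrak U\ast(s\ast\overline s)\ast\mathfrak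 V\leftrightarrow\mathfrak U\ast\operatorname{Id}_Y\ast\mathfrak V$; (v) $\mathfrak U\ast(\overline s\ast s)\ast\mathfrak V\leftrightarrow\mathfrak U\ast\operatorname{Id}_X\ast\mathfrak V$. Two words are equivalent if they are connected by finitely many elementary rewritings. $\mathcal A[S^{-1}]$ has the objects of $\mathcal A$, its morphisms $X\to Y$ are the equivalence classes $[\mathfrak P]$ of words from $X$ to $Y$, and composition is induced by $\ast$. Define $\ell(\mathfrak P)=\min\{|\mathfrak P'| : [\mathfrak P']=[\mathfrak P]\}$. For words with $[\mathfrak P]=[\mathfrak Q]$, $\delta(\mathfrak P,\mathfrak Q)\in\mathbb N$ is the least number of elementary rewriting steps needed to rewrite $\mathfrak P$ as $\mathfrak Q$. The supremum of the empty set is $0$. $S$ is closed under $I$-indexed coproducts (resp. products) if for every family $(s_i:X_i\to Y_i)_{i\in I}$ of morphisms in $S$, the induced morphism $\coprod_{i}s_i:\coprod_i X_i\to\coprod_i Y_i$ (resp. $\prod_i s_i:\prod_i X_i\to\prod_i Y_i$) is in $S$. *)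

theory Defs
  imports Main "HOL-Library.FuncSet" "HOL-Library.Extended_Nat"
begin

section \<open>Categories and functors\<close>

record ('o, 'm) cat =
  Obj :: "'o set"
  Mor :: "'m set"
  Dom :: "'m \<Rightarrow> 'o"
  Cod :: "'m \<Rightarrow> 'o"
  Idn :: "'o \<Rightarrow> 'm"
  Comp :: "'m \<Rightarrow> 'm \<Rightarrow> 'm"

text \<open>\<open>Comp C g f\<close> is the composite \<open>g \<circ> f\<close>; it is meaningful only if \<open>Cod C f = Dom C g\<close>.\<close>

definition hom :: "('o, 'm) cat \<Rightarrow> 'o \<Rightarrow> 'o \<Rightarrow> 'm set" where
  "hom C X Y = {f \<in> Mor C. Dom C f = X \<and> Cod C f = Y}"

locale category =
  fixes C :: "('o, 'm) cat"
  assumes dom_obj: "f \<in> Mor C \<Longrightarrow> Dom C f \<in> Obj C"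
    and cod_obj: "f \<in> Mor C \<Longrightarrow> Cod C f \<in> Obj C"
    and idn_hom: "X \<in> Obj C \<Longrightarrow> Idn C X \<in> hom C X X"
    and comp_hom: "f \<in> hom C X Y \<Longrightarrow> g \<in> hom C Y Z \<Longrightarrow> Comp C g f \<in> hom C X Z"
    and idn_left: "f \<in> hom C X Y \<Longrightarrow> Comp C (Idn C Y) f = f"
    and idn_right: "f \<in> hom C X Y \<Longrightarrow> Comp C f (Idn C X) = f"
    and comp_assoc: "f \<in> hom C W X \<Longrightarrow> g \<in> hom C X Y \<Longrightarrow> h \<in> hom C Y Z \<Longrightarrow>
      Comp C (Comp C h g) f = Comp C h (Comp C g f)"

definition is_iso :: "('o, 'm) cat \<Rightarrow> 'm \<Rightarrow> bool" where
  "is_iso C f \<longleftrightarrow> f \<in> Mor C \<and> (\<exists>g \<in> hom C (Cod C f) (Dom C f).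
     Comp C g f = Idn C (Dom C f) \<and> Comp C f g = Idn C (Cod C f))"

record ('o, 'm, 'p, 'n) cfunctor =
  FObj :: "'o \<Rightarrow> 'p"
  FMor :: "'m \<Rightarrow> 'n"

definition is_functor ::
  "('o, 'm) cat \<Rightarrow> ('p, 'n) cat \<Rightarrow> ('o, 'm, 'p, 'n) cfunctor \<Rightarrow> bool" where
  "is_functor C D F \<longleftrightarrow>
     (\<forall>X \<in> Obj C. FObj F X \<in> Obj D \<and> FMor F (Idn C X) = Idn D (FObj F X)) \<and>
     (\<forall>f \<in> Mor C. FMor F f \<in> hom D (FObj F (Dom C f)) (FObj F (Cod C f))) \<and>
     (\<forall>f \<in> Mor C. \<forall>g \<in> Mor C. Cod C f = Dom C g \<longrightarrow>
        FMor F (Comp C g f) = Comp D (FMor F g) (FMor F f))"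

section \<open>Coproducts and products\<close>

definition is_coproduct ::
  "('o, 'm) cat \<Rightarrow> 'i set \<Rightarrow> ('i \<Rightarrow> 'o) \<Rightarrow> 'o \<Rightarrow> ('i \<Rightarrow> 'm) \<Rightarrow> bool" where
  "is_coproduct C I X K inc \<longleftrightarrow>
     K \<in> Obj C \<and> (\<forall>i \<in> I. X i \<in> Obj C \<and> inc i \<in> hom C (X i) K) \<and>
     (\<forall>Z \<in> Obj C. \<forall>f. (\<forall>i \<in> I. f i \<in> hom C (X i) Z) \<longrightarrow>
        (\<exists>!h. h \<in> hom C K Z \<and> (\<forall>i \<in> I. Comp C h (inc i) = f i)))"

definition is_product ::
  "('o, 'm) cat \<Rightarrow> 'i set \<Rightarrow> ('i \<Rightarrow> 'o) \<Rightarrow> 'o \<Rightarrow> ('i \<Rightarrow> 'm) \<Rightarrow> bool" where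
  "is_product C I X K pr \<longleftrightarrow>
     K \<in> Obj C \<and> (\<forall>i \<in> I. X i \<in> Obj C \<and> pr i \<in> hom C K (X i)) \<and>
     (\<forall>Z \<in> Obj C. \<forall>f. (\<forall>i \<in> I. f i \<in> hom C Z (X i)) \<longrightarrow>
        (\<exists>!h. h \<in> hom C Z K \<and> (\<forall>i \<in> I. Comp C (pr i) h = f i)))"

definition has_coproducts :: "('o, 'm) cat \<Rightarrow> 'i set \<Rightarrow> bool" where
  "has_coproducts C I \<longleftrightarrow> (\<forall>X \<in> I \<rightarrow> Obj C. \<exists>K inc. is_coproduct C I X K inc)"

definition has_products :: "('o, 'm) cat \<Rightarrow> 'i set \<Rightarrow> bool" where
  "has_products C I \<longleftrightarrow> (\<forall>X \<in> I \<rightarrow> Obj C. \<exists>K pr. is_product C I X K pr)"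

definition preserves_coproducts ::
  "('o, 'm) cat \<Rightarrow> ('p, 'n) cat \<Rightarrow> ('o, 'm, 'p, 'n) cfunctor \<Rightarrow> 'i set \<Rightarrow> bool" where
  "preserves_coproducts C D F I \<longleftrightarrow>
     (\<forall>X K inc. is_coproduct C I X K inc \<longrightarrow>
        is_coproduct D I (FObj F \<circ> X) (FObj F K) (FMor F \<circ> inc))"

definition preserves_products ::
  "('o, 'm) cat \<Rightarrow> ('p, 'n) cat \<Rightarrow> ('o, 'm, 'p, 'n) cfunctor \<Rightarrow> 'i set \<Rightarrow> bool" where
  "preserves_products C D F I \<longleftrightarrow>
     (\<forall>X K pr. is_product C I X K pr \<longrightarrow>
        is_product D I (FObj F \<circ> X) (FObj F K) (FMor F \<circ> pr))"

definition coproduct_map ::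
  "('o, 'm) cat \<Rightarrow> 'i set \<Rightarrow> 'o \<Rightarrow> ('i \<Rightarrow> 'm) \<Rightarrow> 'o \<Rightarrow> ('i \<Rightarrow> 'm) \<Rightarrow> ('i \<Rightarrow> 'm) \<Rightarrow> 'm" where
  "coproduct_map C I K inc K' inc' s =
     (THE h. h \<in> hom C K K' \<and> (\<forall>i \<in> I. Comp C h (inc i) = Comp C (inc' i) (s i)))"

definition product_map ::
  "('o, 'm) cat \<Rightarrow> 'i set \<Rightarrow> 'o \<Rightarrow> ('i \<Rightarrow> 'm) \<Rightarrow> 'o \<Rightarrow> ('i \<Rightarrow> 'm) \<Rightarrow> ('i \<Rightarrow> 'm) \<Rightarrow> 'm" where
  "product_map C I K pr K' pr' s =
     (THE h. h \<in> hom C K K' \<and> (\<forall>i \<in> I. Comp C (pr' i) h = Comp C (s i) (pr i)))"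

text \<open>
  The induced morphism between the coproducts depends on which coproduct objects are used, and
  \<open>S\<close> need not contain all isomorphisms. Closure is therefore required with respect to some
  choice of a coproduct for every family of objects. When the category has \<open>I\<close>-indexed
  coproducts, this follows from closure for all choices, so as a hypothesis it is the weaker
  reading. Families are extensional functions, so that the chosen coproduct of a family does not
  depend on values outside \<open>I\<close>. Products are treated in the same way.
\<close>

definition closed_under_coproducts :: "('o, 'm) cat \<Rightarrow> 'i set \<Rightarrow> 'm set \<Rightarrow> bool" where
  "closed_under_coproducts C I S \<longleftrightarrow>
     (\<exists>K inc. (\<forall>X \<in> I \<rightarrow>\<^sub>E Obj C. is_coproduct C I X (K X) (inc X)) \<and>
        (\<forall>s \<in> I \<rightarrow>\<^sub>E S. let X = (\<lambda>i\<in>I. Dom C (s i)); Y = (\<lambda>i\<in>I. Cod C (s i)) in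
           coproduct_map C I (K X) (inc X) (K Y) (inc Y) s \<in> S))"

definition closed_under_products :: "('o, 'm) cat \<Rightarrow> 'i set \<Rightarrow> 'm set \<Rightarrow> bool" where
  "closed_under_products C I S \<longleftrightarrow>
     (\<exists>K pr. (\<forall>X \<in> I \<rightarrow>\<^sub>E Obj C. is_product C I X (K X) (pr X)) \<and>
        (\<forall>s \<in> I \<rightarrow>\<^sub>E S. let X = (\<lambda>i\<in>I. Dom C (s i)); Y = (\<lambda>i\<in>I. Cod C (s i)) in
           product_map C I (K X) (pr X) (K Y) (pr Y) s \<in> S))"

section \<open>Words and elementary rewritings\<close>

datatype 'm arrow = Arr 'm | Bar 'm

fun src :: "('o, 'm) cat \<Rightarrow> 'm arrow \<Rightarrow> 'o" where
  "src A (Arr f) = Dom A f"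
| "src A (Bar s) = Cod A s"

fun tgt :: "('o, 'm) cat \<Rightarrow> 'm arrow \<Rightarrow> 'o" where
  "tgt A (Arr f) = Cod A f"
| "tgt A (Bar s) = Dom A s"

definition arrows :: "('o, 'm) cat \<Rightarrow> 'm set \<Rightarrow> 'm arrow set" where
  "arrows A S = Arr ` Mor A \<union> Bar ` S"

text \<open>
  The word \<open>a\<^sub>m \<ast> \<dots> \<ast> a\<^sub>1\<close> is the list \<open>[a\<^sub>m, \<dots>, a\<^sub>1]\<close>, so formal composition is \<open>@\<close> and
  the arrow applied first is the last entry of the list.
\<close>

definition words :: "('o, 'm) cat \<Rightarrow> 'm set \<Rightarrow> 'm arrow list set" where
  "words A S = {w. w \<noteq> [] \<and> set w \<subseteq> arrows A S \<and> successively (\<lambda>b a. src A b = tgt A a) w}"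

definition word_src :: "('o, 'm) cat \<Rightarrow> 'm arrow list \<Rightarrow> 'o" where
  "word_src A w = src A (last w)"

definition word_tgt :: "('o, 'm) cat \<Rightarrow> 'm arrow list \<Rightarrow> 'o" where
  "word_tgt A w = tgt A (hd w)"

inductive rule :: "('o, 'm) cat \<Rightarrow> 'm set \<Rightarrow> 'm arrow list \<Rightarrow> 'm arrow list \<Rightarrow> bool"
  for A S where
  rule_comp: "f \<in> Mor A \<Longrightarrow> g \<in> Mor A \<Longrightarrow> Cod A f = Dom A g \<Longrightarrow>
    rule A S [Arr g, Arr f] [Arr (Comp A g f)]"
| rule_idl: "a \<in> arrows A S \<Longrightarrow> rule A S [Arr (Idn A (tgt A a)), a] [a]"
| rule_idr: "a \<in> arrows A S \<Longrightarrow> rule A S [a, Arr (Idn A (src A a))] [a]"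
| rule_inv_right: "s \<in> S \<Longrightarrow> rule A S [Arr s, Bar s] [Arr (Idn A (Cod A s))]"
| rule_inv_left: "s \<in> S \<Longrightarrow> rule A S [Bar s, Arr s] [Arr (Idn A (Dom A s))]"

definition rewriting :: "('o, 'm) cat \<Rightarrow> 'm set \<Rightarrow> 'm arrow list rel" where
  "rewriting A S = {(U @ p @ V, U @ q @ V) | U p q V.
     (rule A S p q \<or> rule A S q p) \<and> U @ p @ V \<in> words A S \<and> U @ q @ V \<in> words A S}"

definition word_equiv :: "('o, 'm) cat \<Rightarrow> 'm set \<Rightarrow> 'm arrow list rel" where
  "word_equiv A S = {(P, Q). P \<in> words A S \<and> Q \<in> words A S \<and> (P, Q) \<in> (rewriting A S)\<^sup>*}"

definition word_class :: "('o, 'm) cat \<Rightarrow> 'm set \<Rightarrow> 'm arrow list \<Rightarrow> 'm arrow list set" where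
  "word_class A S P = word_equiv A S `` {P}"

definition word_length :: "('o, 'm) cat \<Rightarrow> 'm set \<Rightarrow> 'm arrow list \<Rightarrow> nat" where
  "word_length A S P =
     (LEAST n. \<exists>P' \<in> words A S. word_class A S P' = word_class A S P \<and> length P' = n)"

text \<open>Only meaningful for equivalent words \<open>P\<close> and \<open>Q\<close>.\<close>

definition rewriting_dist :: "('o, 'm) cat \<Rightarrow> 'm set \<Rightarrow> 'm arrow list \<Rightarrow> 'm arrow list \<Rightarrow> nat"
  where "rewriting_dist A S P Q = (LEAST n. (P, Q) \<in> rewriting A S ^^ n)"

section \<open>The localization\<close>

text \<open>
  Equivalent words have the same source and target, so these are well defined on classes, and
  formal composition respects equivalence, so the union in the composition is a single class;
  see \<open>loc_dom\<close>, \<open>loc_cod\<close> and \<open>loc_comp\<close> below.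
\<close>

definition localization ::
  "('o, 'm) cat \<Rightarrow> 'm set \<Rightarrow> ('o, 'm arrow list set) cat" where
  "localization A S =
     \<lparr>Obj = Obj A,
      Mor = words A S // word_equiv A S,
      Dom = (\<lambda>c. THE X. \<exists>P \<in> c. word_src A P = X),
      Cod = (\<lambda>c. THE X. \<exists>P \<in> c. word_tgt A P = X),
      Idn = (\<lambda>X. word_class A S [Arr (Idn A X)]),
      Comp = (\<lambda>d c. \<Union>Q \<in> d. \<Union>P \<in> c. word_class A S (Q @ P))\<rparr>"

definition localization_functor ::
  "('o, 'm) cat \<Rightarrow> 'm set \<Rightarrow> ('o, 'm, 'o, 'm arrow list set) cfunctor" where
  "localization_functor A S = \<lparr>FObj = (\<lambda>X. X), FMor = (\<lambda>f. word_class A S [Arr f])\<rparr>"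

subsection \<open>Well-definedness\<close>

lemma rewriting_sym: "(P, Q) \<in> rewriting A S \<Longrightarrow> (Q, P) \<in> rewriting A S"
  unfolding rewriting_def by blast

lemma rewriting_words: "(P, Q) \<in> rewriting A S \<Longrightarrow> P \<in> words A S \<and> Q \<in> words A S"
  unfolding rewriting_def by blast

lemma equiv_word_equiv: "equiv (words A S) (word_equiv A S)"
proof (rule equivI)
  show "word_equiv A S \<subseteq> words A S \<times> words A S" by (auto simp: word_equiv_def)
  show "refl_on (words A S) (word_equiv A S)" by (auto simp: refl_on_def word_equiv_def)
  have "sym (rewriting A S)" by (auto simp: sym_def rewriting_sym)
  then have "sym ((rewriting A S)\<^sup>*)" by (rule sym_rtrancl)
  then show "sym (word_equiv A S)" by (auto simp: sym_def word_equiv_def)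
  show "trans (word_equiv A S)" by (auto simp: trans_def word_equiv_def)
qed

lemma word_class_eq_iff:
  "P \<in> words A S \<Longrightarrow> Q \<in> words A S \<Longrightarrow>
     word_class A S P = word_class A S Q \<longleftrightarrow> (P, Q) \<in> word_equiv A S"
  unfolding word_class_def by (rule eq_equiv_class_iff[OF equiv_word_equiv])

lemma words_append:
  assumes "Q \<noteq> []" "P \<noteq> []"
  shows "Q @ P \<in> words A S \<longleftrightarrow> Q \<in> words A S \<and> P \<in> words A S \<and> word_src A Q = word_tgt A P"
  using assms by (auto simp: words_def successively_append_iff word_src_def word_tgt_def)

locale localizing = category A for A :: "('o, 'm) cat" +
  fixes S :: "'m set"
  assumes S_sub: "S \<subseteq> Mor A"
begin

lemma rule_ends:
  assumes "rule A S p q"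
  shows "p \<noteq> [] \<and> q \<noteq> [] \<and> word_src A p = word_src A q \<and> word_tgt A p = word_tgt A q"
  using assms
proof cases
  case (rule_comp f g)
  then have "Comp A g f \<in> hom A (Dom A f) (Cod A g)"
    by (intro comp_hom) (auto simp: hom_def)
  with rule_comp show ?thesis by (auto simp: word_src_def word_tgt_def hom_def)
next
  case (rule_idl a)
  then have "tgt A a \<in> Obj A" using S_sub by (auto simp: arrows_def cod_obj dom_obj)
  then show ?thesis using rule_idl idn_hom by (auto simp: word_src_def word_tgt_def hom_def)
next
  case (rule_idr a)
  then have "src A a \<in> Obj A" using S_sub by (auto simp: arrows_def cod_obj dom_obj)
  then show ?thesis using rule_idr idn_hom by (auto simp: word_src_def word_tgt_def hom_def)
next
  case (rule_inv_right s)
  then have "Cod A s \<in> Obj A" using S_sub by (auto simp: cod_obj)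
  then show ?thesis using rule_inv_right idn_hom by (auto simp: word_src_def word_tgt_def hom_def)
next
  case (rule_inv_left s)
  then have "Dom A s \<in> Obj A" using S_sub by (auto simp: dom_obj)
  then show ?thesis using rule_inv_left idn_hom by (auto simp: word_src_def word_tgt_def hom_def)
qed

lemma rewriting_ends:
  assumes "(P, Q) \<in> rewriting A S"
  shows "word_src A P = word_src A Q \<and> word_tgt A P = word_tgt A Q"
proof -
  obtain U p q V where *: "P = U @ p @ V" "Q = U @ q @ V" "rule A S p q \<or> rule A S q p"
    using assms unfolding rewriting_def by blast
  then have "p \<noteq> [] \<and> q \<noteq> [] \<and> word_src A p = word_src A q \<and> word_tgt A p = word_tgt A q"
    using rule_ends by metis
  then show ?thesis using * by (auto simp: word_src_def word_tgt_def last_append hd_append)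
qed

lemma equiv_ends:
  assumes "(P, Q) \<in> word_equiv A S"
  shows "word_src A P = word_src A Q \<and> word_tgt A P = word_tgt A Q"
proof -
  have "(P, Q) \<in> (rewriting A S)\<^sup>*" using assms by (auto simp: word_equiv_def)
  then show ?thesis by induction (use rewriting_ends in auto)
qed

lemma rewriting_append_right:
  assumes "(P, P') \<in> rewriting A S" "Q \<in> words A S" "word_src A P = word_tgt A Q"
  shows "(P @ Q, P' @ Q) \<in> rewriting A S"
proof -
  obtain U p q V where *: "P = U @ p @ V" "P' = U @ q @ V" "rule A S p q \<or> rule A S q p"
    using assms unfolding rewriting_def by blast
  have w: "P \<in> words A S" "P' \<in> words A S" using rewriting_words assms by blast+
  then have "P @ Q \<in> words A S" "P' @ Q \<in> words A S"
    using assms rewriting_ends[OF assms(1)] words_append[of P Q A S] words_append[of P' Q A S]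
    by (auto simp: words_def)
  then show ?thesis unfolding rewriting_def using *
    by (intro CollectI exI[of _ U] exI[of _ p] exI[of _ q] exI[of _ "V @ Q"]) auto
qed

lemma rewriting_append_left:
  assumes "(P, P') \<in> rewriting A S" "Q \<in> words A S" "word_src A Q = word_tgt A P"
  shows "(Q @ P, Q @ P') \<in> rewriting A S"
proof -
  obtain U p q V where *: "P = U @ p @ V" "P' = U @ q @ V" "rule A S p q \<or> rule A S q p"
    using assms unfolding rewriting_def by blast
  have w: "P \<in> words A S" "P' \<in> words A S" using rewriting_words assms by blast+
  then have "Q @ P \<in> words A S" "Q @ P' \<in> words A S"
    using assms rewriting_ends[OF assms(1)] words_append[of Q P A S] words_append[of Q P' A S]
    by (auto simp: words_def)
  then show ?thesis unfolding rewriting_def using *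
    by (intro CollectI exI[of _ "Q @ U"] exI[of _ p] exI[of _ q] exI[of _ V]) auto
qed

lemma equiv_append:
  assumes Q: "(Q, Q') \<in> word_equiv A S" and P: "(P, P') \<in> word_equiv A S"
    and ends: "word_src A Q = word_tgt A P"
  shows "(Q @ P, Q' @ P') \<in> word_equiv A S"
proof -
  have w: "Q \<in> words A S" "Q' \<in> words A S" "P \<in> words A S" "P' \<in> words A S"
    using P Q by (auto simp: word_equiv_def)
  have "(Q, Q') \<in> (rewriting A S)\<^sup>*" using Q by (auto simp: word_equiv_def)
  then have 1: "(Q @ P, Q' @ P) \<in> (rewriting A S)\<^sup>* \<and> word_src A Q' = word_src A Q"
    by induction
      (use rewriting_append_right rewriting_ends w ends in \<open>auto intro: rtrancl_into_rtrancl\<close>)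
  have "(P, P') \<in> (rewriting A S)\<^sup>*" using P by (auto simp: word_equiv_def)
  then have 2: "(Q' @ P, Q' @ P') \<in> (rewriting A S)\<^sup>* \<and> word_tgt A P' = word_tgt A P"
    by induction
      (use rewriting_append_left rewriting_ends w ends 1 in \<open>auto intro: rtrancl_into_rtrancl\<close>)
  have "Q @ P \<in> words A S" "Q' @ P' \<in> words A S"
    using w ends 1 2 words_append[of Q P A S] words_append[of Q' P' A S] by (auto simp: words_def)
  with 1 2 show ?thesis by (auto simp: word_equiv_def)
qed

lemma mem_class: "P \<in> words A S \<Longrightarrow> P \<in> word_class A S P"
  by (auto simp: word_class_def word_equiv_def)

lemma loc_obj: "Obj (localization A S) = Obj A"
  by (simp add: localization_def)

lemma loc_idn: "Idn (localization A S) X = word_class A S [Arr (Idn A X)]"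
  by (simp add: localization_def)

lemma loc_dom: "P \<in> words A S \<Longrightarrow> Dom (localization A S) (word_class A S P) = word_src A P"
  unfolding localization_def
  by (auto intro!: the_equality bexI[OF _ mem_class]) (auto simp: word_class_def equiv_ends)

lemma loc_cod: "P \<in> words A S \<Longrightarrow> Cod (localization A S) (word_class A S P) = word_tgt A P"
  unfolding localization_def
  by (auto intro!: the_equality bexI[OF _ mem_class]) (auto simp: word_class_def equiv_ends)

lemma loc_mor: "P \<in> words A S \<Longrightarrow> word_class A S P \<in> Mor (localization A S)"
  by (auto simp: localization_def word_class_def quotientI)

lemma loc_hom_cases:
  assumes "c \<in> hom (localization A S) X Y"
  obtains P where "P \<in> words A S" "c = word_class A S P" "word_src A P = X" "word_tgt A P = Y"
proof -
  have "c \<in> words A S // word_equiv A S" using assms by (auto simp: hom_def localization_def)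
  then obtain P where "P \<in> words A S" "c = word_class A S P"
    by (auto simp: word_class_def elim: quotientE)
  then show thesis using that[of P] assms loc_dom loc_cod by (auto simp: hom_def)
qed

lemma loc_hom:
  "P \<in> words A S \<Longrightarrow> word_src A P = X \<Longrightarrow> word_tgt A P = Y \<Longrightarrow>
    word_class A S P \<in> hom (localization A S) X Y"
  by (auto simp: hom_def loc_dom loc_cod loc_mor)

lemma loc_comp:
  assumes "Q \<in> words A S" "P \<in> words A S" "word_src A Q = word_tgt A P"
  shows "Comp (localization A S) (word_class A S Q) (word_class A S P) = word_class A S (Q @ P)"
proof -
  have "word_class A S (Q' @ P') = word_class A S (Q @ P)"
    if "Q' \<in> word_class A S Q" "P' \<in> word_class A S P" for Q' P'
  proof -
    have e: "(Q @ P, Q' @ P') \<in> word_equiv A S"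
      using that assms(3) by (intro equiv_append) (auto simp: word_class_def)
    then have "word_class A S (Q @ P) = word_class A S (Q' @ P')"
      by (subst word_class_eq_iff) (auto simp: word_equiv_def)
    then show ?thesis ..
  qed
  then have "(\<Union>Q' \<in> word_class A S Q. \<Union>P' \<in> word_class A S P. word_class A S (Q' @ P')) =
      (\<Union>Q' \<in> word_class A S Q. \<Union>P' \<in> word_class A S P. word_class A S (Q @ P))"
    by (intro SUP_cong refl)
  also have "\<dots> = word_class A S (Q @ P)"
    using mem_class[OF assms(1)] mem_class[OF assms(2)] by blast
  finally show ?thesis by (simp add: localization_def)
qed

lemma append_words:
  "Q \<in> words A S \<Longrightarrow> P \<in> words A S \<Longrightarrow> word_src A Q = word_tgt A P \<Longrightarrow> Q @ P \<in> words A S"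
  using words_append[of Q P A S] by (auto simp: words_def)

lemma single_word: "a \<in> arrows A S \<Longrightarrow> [a] \<in> words A S"
  by (auto simp: words_def)

lemma word_ends_obj:
  assumes "P \<in> words A S"
  shows "word_src A P \<in> Obj A" "word_tgt A P \<in> Obj A"
proof -
  have "src A a \<in> Obj A \<and> tgt A a \<in> Obj A" if "a \<in> arrows A S" for a
    using that S_sub by (auto simp: arrows_def dom_obj cod_obj)
  moreover have "last P \<in> arrows A S" "hd P \<in> arrows A S"
    using assms last_in_set[of P] hd_in_set[of P] by (auto simp: words_def)
  ultimately show "word_src A P \<in> Obj A" "word_tgt A P \<in> Obj A"
    by (auto simp: word_src_def word_tgt_def)
qed

lemma idn_word:
  assumes "X \<in> Obj A"
  shows "[Arr (Idn A X)] \<in> words A S" "word_src A [Arr (Idn A X)] = X"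
    "word_tgt A [Arr (Idn A X)] = X"
  using idn_hom[OF assms] by (auto simp: words_def arrows_def hom_def word_src_def word_tgt_def)

lemma rewriting_class:
  assumes "(P, Q) \<in> rewriting A S"
  shows "word_class A S P = word_class A S Q"
  using assms rewriting_words[OF assms] by (subst word_class_eq_iff) (auto simp: word_equiv_def)

lemma class_idn_left:
  assumes "P \<in> words A S"
  shows "word_class A S ([Arr (Idn A (word_tgt A P))] @ P) = word_class A S P"
proof (rule rewriting_class)
  obtain a V where P: "P = a # V" using assms by (cases P) (auto simp: words_def)
  then have "rule A S [Arr (Idn A (word_tgt A P)), a] [a]"
    using assms by (auto simp: word_tgt_def words_def intro: rule_idl)
  moreover have "[Arr (Idn A (word_tgt A P))] @ P \<in> words A S"
    using assms by (intro append_words idn_word word_ends_obj)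
  ultimately show "([Arr (Idn A (word_tgt A P))] @ P, P) \<in> rewriting A S"
    unfolding rewriting_def using P assms
    by (intro CollectI exI[of _ "[]"] exI[of _ "[Arr (Idn A (word_tgt A P)), a]"] exI[of _ "[a]"]
        exI[of _ V]) auto
qed

lemma class_idn_right:
  assumes "P \<in> words A S"
  shows "word_class A S (P @ [Arr (Idn A (word_src A P))]) = word_class A S P"
proof (rule rewriting_class)
  obtain a U where P: "P = U @ [a]"
    using assms by (cases P rule: rev_cases) (auto simp: words_def)
  then have "rule A S [a, Arr (Idn A (word_src A P))] [a]"
    using assms by (auto simp: word_src_def words_def intro: rule_idr)
  moreover have "P @ [Arr (Idn A (word_src A P))] \<in> words A S"
    using assms by (intro append_words) (simp_all add: idn_word word_ends_obj)
  ultimately show "(P @ [Arr (Idn A (word_src A P))], P) \<in> rewriting A S"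
    unfolding rewriting_def using P assms
    by (intro CollectI exI[of _ U] exI[of _ "[a, Arr (Idn A (word_src A P))]"] exI[of _ "[a]"]
        exI[of _ "[]"]) auto
qed

theorem localization_category: "category (localization A S)"
proof
  fix c assume "c \<in> Mor (localization A S)"
  then obtain P where "P \<in> words A S" "c = word_class A S P"
    by (auto simp: localization_def word_class_def elim: quotientE)
  then show "Dom (localization A S) c \<in> Obj (localization A S)"
    "Cod (localization A S) c \<in> Obj (localization A S)"
    by (simp_all add: loc_obj loc_dom loc_cod word_ends_obj)
next
  fix X assume "X \<in> Obj (localization A S)"
  then have "X \<in> Obj A" by (simp add: localization_def)
  then show "Idn (localization A S) X \<in> hom (localization A S) X X"
    by (simp add: loc_idn idn_word loc_hom)
next
  fix c d X Y Z
  assume "c \<in> hom (localization A S) X Y" "d \<in> hom (localization A S) Y Z"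
  then obtain P Q where *: "P \<in> words A S" "c = word_class A S P" "word_src A P = X"
    "word_tgt A P = Y" "Q \<in> words A S" "d = word_class A S Q" "word_src A Q = Y" "word_tgt A Q = Z"
    by (elim loc_hom_cases) blast
  have e: "word_src A Q = word_tgt A P" using * by simp
  have "word_src A (Q @ P) = X" "word_tgt A (Q @ P) = Z"
    using * by (auto simp: words_def word_src_def word_tgt_def hd_append)
  then show "Comp (localization A S) d c \<in> hom (localization A S) X Z"
    unfolding *(2,6) loc_comp[OF *(5,1) e]
    using append_words[OF *(5,1) e] by (intro loc_hom)
next
  fix c X Y
  assume "c \<in> hom (localization A S) X Y"
  then obtain P where P: "P \<in> words A S" "c = word_class A S P" "word_src A P = X"
    "word_tgt A P = Y" by (rule loc_hom_cases)
  have O: "X \<in> Obj A" "Y \<in> Obj A" using P word_ends_obj by auto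
  show "Comp (localization A S) (Idn (localization A S) Y) c = c"
    unfolding loc_idn P(2)
    using loc_comp[OF idn_word(1)[OF O(2)] P(1)] idn_word(2)[OF O(2)] class_idn_left[OF P(1)] P(4)
    by simp
  show "Comp (localization A S) c (Idn (localization A S) X) = c"
    unfolding loc_idn P(2)
    using loc_comp[OF P(1) idn_word(1)[OF O(1)]] idn_word(3)[OF O(1)] class_idn_right[OF P(1)] P(3)
    by simp
next
  fix c d e W X Y Z
  assume "c \<in> hom (localization A S) W X" "d \<in> hom (localization A S) X Y"
    "e \<in> hom (localization A S) Y Z"
  then obtain P Q R where *: "P \<in> words A S" "c = word_class A S P" "word_src A P = W"
    "word_tgt A P = X" "Q \<in> words A S" "d = word_class A S Q" "word_src A Q = X" "word_tgt A Q = Y"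
    "R \<in> words A S" "e = word_class A S R" "word_src A R = Y" "word_tgt A R = Z"
    by (elim loc_hom_cases) blast
  have 1: "Q @ P \<in> words A S" "R @ Q \<in> words A S" by (intro append_words; simp add: *)+
  have 2: "word_src A R = word_tgt A Q" "word_src A Q = word_tgt A P"
    "word_src A R = word_tgt A (Q @ P)" "word_src A (R @ Q) = word_tgt A P"
    using * by (auto simp: words_def word_src_def word_tgt_def hd_append)
  have "Comp (localization A S) (Comp (localization A S) e d) c = word_class A S ((R @ Q) @ P)"
    unfolding *(2,6,10) loc_comp[OF *(9,5) 2(1)] by (rule loc_comp[OF 1(2) *(1) 2(4)])
  moreover have
    "Comp (localization A S) e (Comp (localization A S) d c) = word_class A S (R @ (Q @ P))"
    unfolding *(2,6,10) loc_comp[OF *(5,1) 2(2)] by (rule loc_comp[OF *(9) 1(1) 2(3)])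
  ultimately show "Comp (localization A S) (Comp (localization A S) e d) c =
      Comp (localization A S) e (Comp (localization A S) d c)"
    by (metis append_assoc)
qed

theorem localization_functor_functor:
  "is_functor A (localization A S) (localization_functor A S)"
proof -
  have "word_class A S [Arr (Comp A g f)] =
      Comp (localization A S) (word_class A S [Arr g]) (word_class A S [Arr f])"
    if "f \<in> Mor A" "g \<in> Mor A" "Cod A f = Dom A g" for f g
  proof -
    have w: "[Arr f] \<in> words A S" "[Arr g] \<in> words A S" "[Arr g] @ [Arr f] \<in> words A S"
      using that by (auto simp: words_def arrows_def)
    have c: "Comp A g f \<in> Mor A"
      using comp_hom[of f "Dom A f" "Cod A f" g "Cod A g"] that by (auto simp: hom_def)
    then have "[Arr (Comp A g f)] \<in> words A S" by (auto simp: words_def arrows_def)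
    then have "([Arr g] @ [Arr f], [Arr (Comp A g f)]) \<in> rewriting A S"
      unfolding rewriting_def using w rule_comp[OF that]
      by (intro CollectI exI[of _ "[]"] exI[of _ "[Arr g, Arr f]"]
          exI[of _ "[Arr (Comp A g f)]"]) auto
    note r = rewriting_class[OF this]
    have "word_src A [Arr g] = word_tgt A [Arr f]"
      using that by (simp add: word_src_def word_tgt_def)
    from loc_comp[OF w(2,1) this] r show ?thesis by (rule trans[THEN sym])
  qed
  moreover have "word_class A S [Arr f] \<in> hom (localization A S) (Dom A f) (Cod A f)"
    if "f \<in> Mor A" for f
    using that by (intro loc_hom) (auto simp: words_def arrows_def word_src_def word_tgt_def)
  ultimately show ?thesis
    unfolding is_functor_def localization_functor_def loc_obj loc_idn cfunctor.simps
    by (intro conjI ballI impI) simp_all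
qed

theorem localization_functor_inverts:
  assumes "s \<in> S"
  shows "is_iso (localization A S) (FMor (localization_functor A S) s)"
proof -
  have m: "s \<in> Mor A" using assms S_sub by blast
  have w: "[Arr s] \<in> words A S" "[Bar s] \<in> words A S"
    "[Bar s] @ [Arr s] \<in> words A S" "[Arr s] @ [Bar s] \<in> words A S"
    using assms m by (auto simp: words_def arrows_def)
  have O: "Dom A s \<in> Obj A" "Cod A s \<in> Obj A" using m by (auto simp: dom_obj cod_obj)
  have "([Bar s] @ [Arr s], [Arr (Idn A (Dom A s))]) \<in> rewriting A S"
    unfolding rewriting_def using w rule_inv_left[OF assms, of A] idn_word(1)[OF O(1)]
    by (intro CollectI exI[of _ "[]"] exI[of _ "[Bar s, Arr s]"]
          exI[of _ "[Arr (Idn A (Dom A s))]"]) auto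
  note 1 = rewriting_class[OF this]
  have "([Arr s] @ [Bar s], [Arr (Idn A (Cod A s))]) \<in> rewriting A S"
    unfolding rewriting_def using w rule_inv_right[OF assms, of A] idn_word(1)[OF O(2)]
    by (intro CollectI exI[of _ "[]"] exI[of _ "[Arr s, Bar s]"]
          exI[of _ "[Arr (Idn A (Cod A s))]"]) auto
  note 2 = rewriting_class[OF this]
  have e: "word_src A [Arr s] = Dom A s" "word_tgt A [Arr s] = Cod A s"
    "word_src A [Bar s] = Cod A s" "word_tgt A [Bar s] = Dom A s"
    by (auto simp: word_src_def word_tgt_def)
  have d: "Dom (localization A S) (word_class A S [Arr s]) = Dom A s"
    "Cod (localization A S) (word_class A S [Arr s]) = Cod A s"
    using loc_dom[OF w(1)] loc_cod[OF w(1)] e by simp_all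
  have "word_class A S [Bar s] \<in> hom (localization A S) (Cod A s) (Dom A s)"
    using w(2) e by (intro loc_hom)
  moreover have "Comp (localization A S) (word_class A S [Bar s]) (word_class A S [Arr s]) =
      word_class A S [Arr (Idn A (Dom A s))]"
    unfolding 1[symmetric] using w e by (intro loc_comp) simp_all
  moreover have "Comp (localization A S) (word_class A S [Arr s]) (word_class A S [Bar s]) =
      word_class A S [Arr (Idn A (Cod A s))]"
    unfolding 2[symmetric] using w e by (intro loc_comp) simp_all
  ultimately show ?thesis
    unfolding is_iso_def localization_functor_def cfunctor.simps d loc_idn
    using loc_mor[OF w(1)] by blast
qed

end

end

theory Submission
  imports Defs
begin

text \<open>
  Write \<open>L\<close> for the localization and \<open>Q\<close> for the functor from \<open>A\<close> to \<open>L\<close>. In \<open>A\<close>, forming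
  coproducts is a functor from \<open>A\<^sup>I\<close> to \<open>A\<close>, left adjoint to the diagonal. By closure of \<open>S\<close>, its
  composite \<open>F\<close> with \<open>Q\<close> inverts every family in \<open>S\<^sup>I\<close>. Suppose that \<open>F\<close> extends along \<open>Q\<^sup>I\<close> to a
  functor \<open>G\<close> from \<open>L\<^sup>I\<close> to \<open>L\<close>. Then \<open>G\<close> is left adjoint to the diagonal of \<open>L\<close>: the inclusions
  and the codiagonals are natural for morphisms of \<open>A\<close>, hence for inverses of morphisms of \<open>S\<close>,
  hence for all composites of these, and the triangle identities are inherited from \<open>A\<close>. This is
  \<open>coproducts_of_power_localization\<close>.

  So the point is that \<open>L\<^sup>I\<close> is again a localization of \<open>A\<^sup>I\<close>, which is where the two suprema
  enter. A morphism of \<open>L\<^sup>I\<close> is a family of classes of words; as the lengths can be bounded by \<open>N\<close>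
  uniformly in the family, it is a composite of finitely many fractions of families
  (\<open>power_localization_fraction\<close>). Two families of words of bounded length that are equivalent entry
  by entry are connected by a uniformly bounded number of steps, so finitely many steps performed
  on all entries in parallel suffice. The hypothesis on \<open>\<delta>\<close> covers words of length at most \<open>N + 1\<close>
  only; since a longer word can be shortened one letter at a time, this bounds the distance
  between words of any given length (\<open>uniform_rewriting_distance\<close>).

  It remains to see that a parallel step is harmless even though different entries may be rewritten
  by different rules, at different places (\<open>functor_extends_along_power\<close>). A family of words of
  equal length is read as a list of columns, and a column of letters of mixed kinds is evaluated
  as one fraction, with \<open>f\<close> read as \<open>id\<^bsup>-1\<^esup> f\<close> and the formal inverse of \<open>s\<close> as \<open>s\<^bsup>-1\<^esup> id\<close>; here
  \<open>S\<close> has to contain the identities. For every rule, whatever its kind, the two fractions on its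
  left compose to the fraction on its right by the same diagram (\<open>rule_square\<close>), so the rules may be
  mixed. Identities inserted as padding turn rewritings into moves that replace two adjacent letters
  by two others, so the columns stay aligned.

  Products follow by applying the same abstract statement to the opposite categories. What it needs
  to know about \<open>A\<close>, \<open>L\<close> and \<open>Q\<close> is self-dual, so the localization of the opposite category does
  not have to be identified.
\<close>

section \<open>Inverses, opposite categories and powers\<close>

definition inverse_mor :: "('o, 'm) cat \<Rightarrow> 'm \<Rightarrow> 'm \<Rightarrow> bool" where
  "inverse_mor C f g \<longleftrightarrow> f \<in> Mor C \<and> g \<in> hom C (Cod C f) (Dom C f) \<and>
     Comp C g f = Idn C (Dom C f) \<and> Comp C f g = Idn C (Cod C f)"

lemma is_iso_iff_inverse: "is_iso C f \<longleftrightarrow> (\<exists>g. inverse_mor C f g)"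
  unfolding is_iso_def inverse_mor_def by blast

lemma homD: "f \<in> hom C X Y \<Longrightarrow> f \<in> Mor C \<and> Dom C f = X \<and> Cod C f = Y"
  by (simp add: hom_def)

context category
begin

lemma hom_obj: "f \<in> hom C X Y \<Longrightarrow> X \<in> Obj C \<and> Y \<in> Obj C"
  using dom_obj cod_obj by (auto simp: hom_def)

lemma comp_mor:
  assumes "f \<in> Mor C" "g \<in> Mor C" "Cod C f = Dom C g"
  shows "Comp C g f \<in> Mor C" "Dom C (Comp C g f) = Dom C f" "Cod C (Comp C g f) = Cod C g"
  using comp_hom[of f "Dom C f" "Cod C f" g "Cod C g"] assms by (auto simp: hom_def)

lemma inverse_hom:
  assumes "inverse_mor C f g" "f \<in> hom C X Y"
  shows "g \<in> hom C Y X" "Comp C g f = Idn C X" "Comp C f g = Idn C Y"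
  using assms by (auto simp: inverse_mor_def hom_def)

lemma inverse_unique:
  assumes "inverse_mor C f g" "inverse_mor C f g'"
  shows "g = g'"
proof -
  have f: "f \<in> hom C (Dom C f) (Cod C f)" using assms by (auto simp: inverse_mor_def hom_def)
  note i = inverse_hom[OF assms(1) f] and j = inverse_hom[OF assms(2) f]
  have "g = Comp C (Comp C g f) g'"
    using comp_assoc[OF j(1) f i(1)] i j idn_right[OF i(1)] by simp
  then show ?thesis using i(2) idn_left[OF j(1)] by simp
qed

lemma inverse_idn: "X \<in> Obj C \<Longrightarrow> inverse_mor C (Idn C X) (Idn C X)"
  using idn_hom[of X] idn_left[OF idn_hom, of X] by (auto simp: inverse_mor_def hom_def)

lemma inverse_cancel:
  assumes "inverse_mor C f g" "f \<in> hom C Y Z" "x \<in> hom C X Y" "y \<in> hom C X Y"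
    and "Comp C f x = Comp C f y"
  shows "x = y"
proof -
  note i = inverse_hom[OF assms(1,2)]
  have "x = Comp C g (Comp C f x)"
    using comp_assoc[OF assms(3,2) i(1)] i idn_left[OF assms(3)] by simp
  also have "\<dots> = Comp C g (Comp C f y)" using assms(5) by simp
  also have "\<dots> = y"
    using comp_assoc[OF assms(4,2) i(1)] i idn_left[OF assms(4)] by simp
  finally show ?thesis .
qed

lemma cancel_inner:
  assumes "inverse_mor C s s'" "s \<in> hom C Y M" "f \<in> hom C X M"
  shows "Comp C s (Comp C s' f) = f"
  using comp_assoc[OF assms(3) inverse_hom(1)[OF assms(1,2)] assms(2)]
    inverse_hom(3)[OF assms(1,2)] idn_left[OF assms(3)] by simp

text \<open>Suppressing composition signs, the claim is \<open>t\<^bsup>-1\<^esup> g s\<^bsup>-1\<^esup> f = u\<^bsup>-1\<^esup> h\<close>. The square \<open>p g = q s\<close> moves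
  the inner inverse to the left, as in a calculus of fractions: \<open>g s\<^bsup>-1\<^esup> = p\<^bsup>-1\<^esup> q\<close>. The resulting
  fraction \<open>(p t)\<^bsup>-1\<^esup> (q f)\<close> is \<open>u\<^bsup>-1\<^esup> h\<close> expanded by \<open>r\<close>.\<close>

lemma comp_of_fractions:
  assumes f: "f \<in> hom C X M" and s: "s \<in> hom C Y M" "inverse_mor C s s'"
    and g: "g \<in> hom C Y N" and t: "t \<in> hom C Z N" "inverse_mor C t t'"
    and h: "h \<in> hom C X K" and u: "u \<in> hom C Z K" "inverse_mor C u u'"
    and p: "p \<in> hom C N P" "inverse_mor C p p'"
    and q: "q \<in> hom C M P" and r: "r \<in> hom C K P"
    and ore: "Comp C p g = Comp C q s"
    and eqs: "Comp C p t = Comp C r u" "Comp C r h = Comp C q f"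
  shows "Comp C (Comp C t' g) (Comp C s' f) = Comp C u' h"
proof -
  note s' = inverse_hom(1)[OF s(2,1)] and t' = inverse_hom(1)[OF t(2,1)]
    and u' = inverse_hom(1)[OF u(2,1)]
  have sf: "Comp C s' f \<in> hom C X Y" and gsf: "Comp C g (Comp C s' f) \<in> hom C X N"
    and uh: "Comp C u' h \<in> hom C X Z"
    using f s' g u' h by (auto intro: comp_hom)
  let ?x = "Comp C t' (Comp C g (Comp C s' f))"
  have x: "?x \<in> hom C X Z" by (rule comp_hom[OF gsf t'])
  have tuh: "Comp C t (Comp C u' h) \<in> hom C X N" by (rule comp_hom[OF uh t(1)])
  have "Comp C p (Comp C t ?x) = Comp C p (Comp C g (Comp C s' f))"
    using cancel_inner[OF t(2,1) gsf] by simp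
  also have "\<dots> = Comp C q (Comp C s (Comp C s' f))"
    using comp_assoc[OF sf g p(1)] comp_assoc[OF sf s(1) q] ore by simp
  also have "\<dots> = Comp C r h" using cancel_inner[OF s(2,1) f] eqs by simp
  also have "\<dots> = Comp C r (Comp C u (Comp C u' h))"
    using cancel_inner[OF u(2,1) h] by simp
  also have "\<dots> = Comp C p (Comp C t (Comp C u' h))"
    using comp_assoc[OF uh u(1) r] comp_assoc[OF uh t(1) p(1)] eqs by simp
  finally have "Comp C t ?x = Comp C t (Comp C u' h)"
    by (rule inverse_cancel[OF p(2,1) comp_hom[OF x t(1)] tuh])
  then have "?x = Comp C u' h" by (rule inverse_cancel[OF t(2,1) x uh])
  then show ?thesis using comp_assoc[OF sf g t'] by simp
qed

end

definition opposite :: "('o, 'm) cat \<Rightarrow> ('o, 'm) cat" where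
  "opposite C = \<lparr>Obj = Obj C, Mor = Mor C, Dom = Cod C, Cod = Dom C, Idn = Idn C,
     Comp = (\<lambda>g f. Comp C f g)\<rparr>"

lemma opposite_simps [simp]:
  "Obj (opposite C) = Obj C" "Mor (opposite C) = Mor C" "Dom (opposite C) = Cod C"
  "Cod (opposite C) = Dom C" "Idn (opposite C) = Idn C"
  "Comp (opposite C) g f = Comp C f g"
  by (simp_all add: opposite_def)

lemma hom_opposite [simp]: "hom (opposite C) X Y = hom C Y X"
  by (auto simp: hom_def)

lemma category_opposite:
  assumes "category C"
  shows "category (opposite C)"
proof -
  interpret category C by fact
  show ?thesis
    by unfold_locales
      (auto simp: dom_obj cod_obj idn_hom idn_left idn_right comp_assoc intro: comp_hom)
qed

lemma inverse_mor_opposite [simp]: "inverse_mor (opposite C) f g \<longleftrightarrow> inverse_mor C f g"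
  by (auto simp: inverse_mor_def)

lemma is_iso_opposite [simp]: "is_iso (opposite C) f \<longleftrightarrow> is_iso C f"
  by (simp add: is_iso_iff_inverse)

lemma is_functor_opposite [simp]: "is_functor (opposite C) (opposite D) F \<longleftrightarrow> is_functor C D F"
  unfolding is_functor_def by auto

lemma is_coproduct_opposite [simp]:
  "is_coproduct (opposite C) I X K pr \<longleftrightarrow> is_product C I X K pr"
  by (simp add: is_coproduct_def is_product_def)

lemma has_coproducts_opposite [simp]: "has_coproducts (opposite C) I \<longleftrightarrow> has_products C I"
  by (simp add: has_coproducts_def has_products_def)

lemma preserves_coproducts_opposite [simp]:
  "preserves_coproducts (opposite C) (opposite D) F I \<longleftrightarrow> preserves_products C D F I"
  by (simp add: preserves_coproducts_def preserves_products_def)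

lemma closed_under_coproducts_opposite [simp]:
  "closed_under_coproducts (opposite C) I S \<longleftrightarrow> closed_under_products C I S"
  by (simp add: closed_under_coproducts_def closed_under_products_def coproduct_map_def
      product_map_def Let_def)

text \<open>Objects and morphisms are extensional families, so that equality in the power is equality at all
  indices in \<open>I\<close>.\<close>

definition power_cat :: "'i set \<Rightarrow> ('o, 'm) cat \<Rightarrow> ('i \<Rightarrow> 'o, 'i \<Rightarrow> 'm) cat" where
  "power_cat I C = \<lparr>Obj = I \<rightarrow>\<^sub>E Obj C, Mor = I \<rightarrow>\<^sub>E Mor C,
     Dom = (\<lambda>f. \<lambda>i\<in>I. Dom C (f i)), Cod = (\<lambda>f. \<lambda>i\<in>I. Cod C (f i)),
     Idn = (\<lambda>X. \<lambda>i\<in>I. Idn C (X i)), Comp = (\<lambda>g f. \<lambda>i\<in>I. Comp C (g i) (f i))\<rparr>"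

definition power_functor ::
  "'i set \<Rightarrow> ('o, 'm, 'p, 'n) cfunctor \<Rightarrow> ('i \<Rightarrow> 'o, 'i \<Rightarrow> 'm, 'i \<Rightarrow> 'p, 'i \<Rightarrow> 'n) cfunctor" where
  "power_functor I F = \<lparr>FObj = (\<lambda>X. \<lambda>i\<in>I. FObj F (X i)), FMor = (\<lambda>f. \<lambda>i\<in>I. FMor F (f i))\<rparr>"

lemma power_simps [simp]:
  "Obj (power_cat I C) = (I \<rightarrow>\<^sub>E Obj C)" "Mor (power_cat I C) = (I \<rightarrow>\<^sub>E Mor C)"
  "Dom (power_cat I C) f = (\<lambda>i\<in>I. Dom C (f i))" "Cod (power_cat I C) f = (\<lambda>i\<in>I. Cod C (f i))"
  "Idn (power_cat I C) X = (\<lambda>i\<in>I. Idn C (X i))"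
  "Comp (power_cat I C) g f = (\<lambda>i\<in>I. Comp C (g i) (f i))"
  by (simp_all add: power_cat_def)

lemma power_functor_simps [simp]:
  "FObj (power_functor I F) X = (\<lambda>i\<in>I. FObj F (X i))"
  "FMor (power_functor I F) f = (\<lambda>i\<in>I. FMor F (f i))"
  by (simp_all add: power_functor_def)

lemma restrict_PiE_eq_iff:
  "f \<in> I \<rightarrow>\<^sub>E A \<Longrightarrow> (\<lambda>i\<in>I. g i) = f \<longleftrightarrow> (\<forall>i\<in>I. g i = f i)"
  "f \<in> I \<rightarrow>\<^sub>E A \<Longrightarrow> f = (\<lambda>i\<in>I. g i) \<longleftrightarrow> (\<forall>i\<in>I. f i = g i)"
  by (auto simp: fun_eq_iff PiE_def extensional_def)

lemma restrict_eq_iff: "(\<lambda>i\<in>I. f i) = (\<lambda>i\<in>I. g i) \<longleftrightarrow> (\<forall>i\<in>I. f i = g i)"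
  by (auto simp: fun_eq_iff restrict_def)

lemma hom_power:
  assumes "X \<in> I \<rightarrow>\<^sub>E A" "Y \<in> I \<rightarrow>\<^sub>E B"
  shows "f \<in> hom (power_cat I C) X Y \<longleftrightarrow> f \<in> extensional I \<and> (\<forall>i\<in>I. f i \<in> hom C (X i) (Y i))"
  by (auto simp: hom_def restrict_PiE_eq_iff[OF assms(1)] restrict_PiE_eq_iff[OF assms(2)] PiE_def)

lemma category_power:
  assumes "category C"
  shows "category (power_cat I C)"
proof -
  interpret category C by fact
  show ?thesis
  proof
    fix f assume "f \<in> Mor (power_cat I C)"
    then show "Dom (power_cat I C) f \<in> Obj (power_cat I C)"
      "Cod (power_cat I C) f \<in> Obj (power_cat I C)"
      by (auto simp: PiE_iff dom_obj cod_obj)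
  next
    fix X assume "X \<in> Obj (power_cat I C)"
    then show "Idn (power_cat I C) X \<in> hom (power_cat I C) X X"
      by (auto simp: hom_power[of _ I "Obj C" _ "Obj C"] PiE_iff idn_hom)
  next
    fix f g X Y Z assume "f \<in> hom (power_cat I C) X Y" "g \<in> hom (power_cat I C) Y Z"
    then show "Comp (power_cat I C) g f \<in> hom (power_cat I C) X Z"
      by (auto simp: hom_def restrict_eq_iff PiE_iff comp_mor)
  next
    fix f X Y assume f: "f \<in> hom (power_cat I C) X Y"
    then have m: "f \<in> I \<rightarrow>\<^sub>E Mor C" and X: "X = (\<lambda>i\<in>I. Dom C (f i))" "Y = (\<lambda>i\<in>I. Cod C (f i))"
      by (auto simp: hom_def)
    show "Comp (power_cat I C) (Idn (power_cat I C) Y) f = f"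
      "Comp (power_cat I C) f (Idn (power_cat I C) X) = f"
      using m unfolding X
      by (simp_all add: restrict_PiE_eq_iff[OF m] idn_left[unfolded hom_def]
          idn_right[unfolded hom_def] PiE_iff)
  next
    fix f g h W X Y Z
    assume "f \<in> hom (power_cat I C) W X" "g \<in> hom (power_cat I C) X Y" "h \<in> hom (power_cat I C) Y Z"
    then show "Comp (power_cat I C) (Comp (power_cat I C) h g) f =
        Comp (power_cat I C) h (Comp (power_cat I C) g f)"
      by (auto simp: hom_def restrict_eq_iff PiE_iff comp_assoc[unfolded hom_def])
  qed
qed

lemma opposite_power: "opposite (power_cat I C) = power_cat I (opposite C)"
  by (simp add: opposite_def power_cat_def)

lemma is_functor_power:
  assumes "is_functor C D F"
  shows "is_functor (power_cat I C) (power_cat I D) (power_functor I F)"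
  using assms unfolding is_functor_def
  by (auto simp: hom_def restrict_eq_iff PiE_iff)

lemma inverse_mor_power:
  assumes "f \<in> I \<rightarrow>\<^sub>E Mor C" "g \<in> extensional I"
  shows "inverse_mor (power_cat I C) f g \<longleftrightarrow> (\<forall>i\<in>I. inverse_mor C (f i) (g i))"
  using assms by (auto simp: inverse_mor_def hom_def restrict_eq_iff PiE_iff)

lemma functorD:
  assumes "is_functor C D F"
  shows "X \<in> Obj C \<Longrightarrow> FObj F X \<in> Obj D"
    and "X \<in> Obj C \<Longrightarrow> FMor F (Idn C X) = Idn D (FObj F X)"
    and "f \<in> hom C X Y \<Longrightarrow> FMor F f \<in> hom D (FObj F X) (FObj F Y)"
    and "f \<in> hom C X Y \<Longrightarrow> g \<in> hom C Y Z \<Longrightarrow> FMor F (Comp C g f) = Comp D (FMor F g) (FMor F f)"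
  using assms by (auto simp: is_functor_def hom_def)

lemma functor_inverse:
  assumes "is_functor C D F" "category C" "inverse_mor C f g"
  shows "inverse_mor D (FMor F f) (FMor F g)"
proof -
  interpret category C by fact
  have f: "f \<in> hom C (Dom C f) (Cod C f)" and g: "g \<in> hom C (Cod C f) (Dom C f)"
    using assms(3) by (auto simp: inverse_mor_def hom_def)
  note F = functorD[OF assms(1)]
  show ?thesis
    using F(3)[OF f] F(3)[OF g] F(4)[OF f g] F(4)[OF g f] assms(3) F(2) hom_obj[OF f]
    by (auto simp: inverse_mor_def hom_def)
qed

section \<open>Padded words and local moves\<close>

text \<open>For nonempty lists this is being a word with the given ends (\<open>path_iff_word\<close>). Admitting the empty
  list, and carrying the ends along, makes it suitable for induction.\<close>

fun path :: "('o, 'm) cat \<Rightarrow> 'm set \<Rightarrow> 'o \<Rightarrow> 'm arrow list \<Rightarrow> 'o \<Rightarrow> bool" where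
  "path A S x [] y \<longleftrightarrow> x \<in> Obj A \<and> x = y"
| "path A S x (a # w) y \<longleftrightarrow> a \<in> arrows A S \<and> tgt A a = y \<and> path A S x w (src A a)"

text \<open>Two pairs of letters are exchanged if they contract to the same letter. This includes sliding an
  identity past a letter, and replacing a contractible pair by its contraction next to an identity.
  Unlike rewritings, moves preserve the length.\<close>

inductive move :: "('o, 'm) cat \<Rightarrow> 'm set \<Rightarrow> 'm arrow list \<Rightarrow> 'm arrow list \<Rightarrow> bool"
  for A S where
  move_refl: "move A S w w"
| move_cons: "move A S v w \<Longrightarrow> move A S (a # v) (a # w)"
| move_head: "rule A S [b, a] [c] \<Longrightarrow> rule A S [b', a'] [c] \<Longrightarrow>
    move A S (b # a # w) (b' # a' # w)"

lemma move_length: "move A S v w \<Longrightarrow> length v = length w"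
  by (induction rule: move.induct) auto

lemma move_sym: "move A S v w \<Longrightarrow> move A S w v"
  by (induction rule: move.induct) (auto intro: move.intros)

lemma move_Cons_cases:
  assumes "move A S (b # v) (b' # w)"
  shows "b = b' \<and> move A S v w \<or> (\<exists>a a' u c. v = a # u \<and> w = a' # u \<and>
     rule A S [b, a] [c] \<and> rule A S [b', a'] [c])"
  using assms by cases (auto intro: move_refl)

lemma moves_cons: "(move A S ^^ k) v w \<Longrightarrow> (move A S ^^ k) (a # v) (a # w)"
proof (induction k arbitrary: w)
  case (Suc k)
  then obtain z where "(move A S ^^ k) v z" "move A S z w" by (auto elim: relpowp_Suc_E)
  then show ?case using Suc.IH move_cons by (metis relpowp_Suc_I)
qed auto

lemma moves_prefix: "(move A S ^^ k) v w \<Longrightarrow> (move A S ^^ k) (u @ v) (u @ w)"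
  by (induction u) (auto intro: moves_cons)

lemma moves_mono:
  assumes "(move A S ^^ k) v w" "k \<le> n"
  shows "(move A S ^^ n) v w"
  using assms(2,1) by (induction rule: dec_induct) (auto intro: relpowp_Suc_I move_refl)

lemma moves_sym: "(move A S ^^ k) v w \<Longrightarrow> (move A S ^^ k) w v"
proof (induction k arbitrary: w)
  case (Suc k)
  then obtain z where "(move A S ^^ k) v z" "move A S z w" by (auto elim: relpowp_Suc_E)
  then show ?case using Suc.IH move_sym by (metis relpowp_Suc_I2)
qed auto

definition pad :: "('o, 'm) cat \<Rightarrow> nat \<Rightarrow> 'o \<Rightarrow> 'm arrow list \<Rightarrow> 'm arrow list" where
  "pad A n y w = replicate (n - length w) (Arr (Idn A y)) @ w"

text \<open>Every letter is read as a fraction with numerator \<open>num\<close> and denominator \<open>den\<close>: the missing part is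
  an identity. The two parts have the common target \<open>apex\<close>.\<close>

fun num :: "('o, 'm) cat \<Rightarrow> 'm arrow \<Rightarrow> 'm" where
  "num A (Arr f) = f"
| "num A (Bar s) = Idn A (Cod A s)"

fun den :: "('o, 'm) cat \<Rightarrow> 'm arrow \<Rightarrow> 'm" where
  "den A (Arr f) = Idn A (Cod A f)"
| "den A (Bar s) = s"

definition apex :: "('o, 'm) cat \<Rightarrow> 'm arrow \<Rightarrow> 'o" where
  "apex A a = Cod A (num A a)"

lemma rule_shape:
  assumes "rule A S p q"
  obtains a b c where "p = [b, a]" "q = [c]"
  using assms by cases auto

locale localizing_with_identities = localizing A S for A :: "('o, 'm) cat" and S :: "'m set" +
  assumes S_idn: "X \<in> Obj A \<Longrightarrow> Idn A X \<in> S"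
begin

lemma S_mor: "s \<in> S \<Longrightarrow> s \<in> Mor A"
  using S_sub by blast

lemma idn_simps [simp]:
  "X \<in> Obj A \<Longrightarrow> Idn A X \<in> Mor A" "X \<in> Obj A \<Longrightarrow> Dom A (Idn A X) = X"
  "X \<in> Obj A \<Longrightarrow> Cod A (Idn A X) = X"
  using idn_hom[of X] by (auto simp: hom_def)

lemma arrow_ends_obj: "a \<in> arrows A S \<Longrightarrow> src A a \<in> Obj A \<and> tgt A a \<in> Obj A"
  by (auto simp: arrows_def dom_obj cod_obj S_mor)

lemma idn_arrow: "X \<in> Obj A \<Longrightarrow> Arr (Idn A X) \<in> arrows A S"
  by (simp add: arrows_def)

lemma path_obj: "path A S x w y \<Longrightarrow> x \<in> Obj A \<and> y \<in> Obj A"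
  by (induction w arbitrary: y) (auto simp: arrow_ends_obj)

lemma path_append_iff: "path A S x (v @ w) z \<longleftrightarrow> (\<exists>y. path A S x w y \<and> path A S y v z)"
  using path_obj by (induction v arbitrary: z) auto

lemma path_iff_word:
  "w \<noteq> [] \<Longrightarrow> path A S x w y \<longleftrightarrow> w \<in> words A S \<and> word_src A w = x \<and> word_tgt A w = y"
proof (induction w arbitrary: y)
  case (Cons a w)
  show ?case
  proof (cases "w = []")
    case True
    then show ?thesis
      using arrow_ends_obj by (auto simp: words_def word_src_def word_tgt_def)
  next
    case False
    then have "a # w \<in> words A S \<longleftrightarrow> a \<in> arrows A S \<and> w \<in> words A S \<and> src A a = word_tgt A w"
      by (auto simp: words_def word_tgt_def successively_Cons)
    then show ?thesis using Cons.IH[OF False, of "src A a"] False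
      by (auto simp: word_src_def word_tgt_def)
  qed
qed simp

lemma rule_arrows:
  assumes "rule A S [b, a] [c]"
  shows "b \<in> arrows A S \<and> a \<in> arrows A S \<and> c \<in> arrows A S \<and> src A b = tgt A a \<and>
    src A c = src A a \<and> tgt A c = tgt A b"
  using assms
  by cases (auto simp: arrows_def S_mor comp_mor dom_obj cod_obj)

lemma move_path: "move A S v w \<Longrightarrow> path A S x v y \<Longrightarrow> path A S x w y"
proof (induction arbitrary: y rule: move.induct)
  case (move_head b a c b' a' w)
  then show ?case using rule_arrows[OF move_head(1)] rule_arrows[OF move_head(2)] by auto
qed auto

lemma pad_path: "path A S x w y \<Longrightarrow> path A S x (pad A n y w) y"
proof -
  assume p: "path A S x w y"
  have "path A S x (replicate k (Arr (Idn A y)) @ w) y" for k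
    using p path_obj[OF p] by (induction k) (auto simp: idn_arrow)
  then show ?thesis by (simp add: pad_def)
qed

lemma moves_slide_identity:
  assumes "path A S x v z" "path A S z u y"
  shows "(move A S ^^ length u) (Arr (Idn A y) # u @ v) (u @ Arr (Idn A z) # v)"
  using assms(2)
proof (induction u arbitrary: y)
  case (Cons a u)
  have "rule A S [Arr (Idn A (tgt A a)), a] [a]" "rule A S [a, Arr (Idn A (src A a))] [a]"
    using Cons.prems by (auto intro: rule_idl rule_idr)
  then have "move A S (Arr (Idn A y) # a # u @ v) (a # Arr (Idn A (src A a)) # u @ v)"
    using Cons.prems by (auto intro: move_head)
  moreover have "(move A S ^^ length u) (Arr (Idn A (src A a)) # u @ v) (u @ Arr (Idn A z) # v)"
    using Cons by auto
  then have "(move A S ^^ length u) (a # Arr (Idn A (src A a)) # u @ v)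
      (a # u @ Arr (Idn A z) # v)" by (rule moves_cons)
  ultimately show ?case unfolding list.size(4) add_Suc_right add_0_right append_Cons
    by (rule relpowp_Suc_I2)
qed simp

text \<open>After contracting, the padded word has one identity more in front. That identity is slid to the
  place of the contraction, where it makes up for the lost letter.\<close>

lemma moves_contraction:
  assumes r: "rule A S [b, a] [c]" and w: "path A S x (u @ [c] @ v) y"
    and n: "length (u @ [b, a] @ v) \<le> n"
  shows "(move A S ^^ n) (pad A n y (u @ [c] @ v)) (pad A n y (u @ [b, a] @ v))"
proof -
  define k where "k = n - length (u @ [b, a] @ v)"
  have c: "c \<in> arrows A S" and p: "path A S x (c # v) (tgt A c)" "path A S (tgt A c) u y"
    using w by (auto simp: path_append_iff)
  have "(move A S ^^ length u) (Arr (Idn A y) # u @ c # v) (u @ Arr (Idn A (tgt A c)) # c # v)"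
    using moves_slide_identity[OF p] .
  moreover have "move A S (Arr (Idn A (tgt A c)) # c # v) (b # a # v)"
    using rule_idl[OF c] r by (rule move_head)
  then have "(move A S ^^ 1) (u @ Arr (Idn A (tgt A c)) # c # v) (u @ b # a # v)"
    by (intro moves_prefix) (metis relpowp_1)
  then have "move A S (u @ Arr (Idn A (tgt A c)) # c # v) (u @ b # a # v)"
    by (metis relpowp_1)
  ultimately have "(move A S ^^ Suc (length u)) (Arr (Idn A y) # u @ c # v) (u @ b # a # v)"
    by (rule relpowp_Suc_I)
  then have "(move A S ^^ n) (Arr (Idn A y) # u @ c # v) (u @ b # a # v)"
    by (rule moves_mono) (use n in simp)
  then have "(move A S ^^ n) (replicate k (Arr (Idn A y)) @ Arr (Idn A y) # u @ c # v)
      (replicate k (Arr (Idn A y)) @ u @ b # a # v)"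
    by (rule moves_prefix)
  moreover have "n - length (u @ [c] @ v) = Suc k" using n by (simp add: k_def)
  ultimately show ?thesis
    by (simp add: pad_def k_def[symmetric] replicate_app_Cons_same del: replicate.simps)
       (simp add: k_def)
qed

lemma moves_of_rewriting:
  assumes "(v, w) \<in> rewriting A S" "path A S x v y" "length v \<le> n" "length w \<le> n"
  shows "(move A S ^^ n) (pad A n y v) (pad A n y w)"
proof -
  obtain u p q t where *: "v = u @ p @ t" "w = u @ q @ t" "rule A S p q \<or> rule A S q p"
    using assms unfolding rewriting_def by blast
  have W: "v \<in> words A S" "w \<in> words A S" using rewriting_words assms by blast+
  then have ne: "v \<noteq> []" "w \<noteq> []" by (auto simp: words_def)
  have w: "path A S x w y"
    using assms(2) W rewriting_ends[OF assms(1)] path_iff_word ne by auto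
  from *(3) show ?thesis
  proof
    assume r: "rule A S p q"
    then obtain a b c where s: "p = [b, a]" "q = [c]" by (rule rule_shape)
    show ?thesis using moves_sym[OF moves_contraction[of b a c x u t y n]] r w assms * s by simp
  next
    assume r: "rule A S q p"
    then obtain a b c where s: "q = [b, a]" "p = [c]" by (rule rule_shape)
    show ?thesis using moves_contraction[of b a c x u t y n] r assms * s by simp
  qed
qed

lemma rewriting_length:
  assumes "(v, w) \<in> rewriting A S"
  shows "length w \<le> Suc (length v)"
proof -
  obtain u p q t where *: "v = u @ p @ t" "w = u @ q @ t" "rule A S p q \<or> rule A S q p"
    using assms unfolding rewriting_def by blast
  then show ?thesis by (auto elim!: rule_shape)
qed

lemma moves_of_rewritings:
  assumes "(v, w) \<in> rewriting A S ^^ m" "path A S x v y" "v \<noteq> []" "length v + m \<le> n"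
  shows "(move A S ^^ (n * m)) (pad A n y v) (pad A n y w)"
  using assms
proof (induction m arbitrary: v)
  case (Suc m)
  then obtain z where z: "(v, z) \<in> rewriting A S" "(z, w) \<in> rewriting A S ^^ m"
    by (meson relpow_Suc_D2)
  have W: "v \<in> words A S" "z \<in> words A S" using rewriting_words z by blast+
  have ne: "z \<noteq> []" using W by (auto simp: words_def)
  have "path A S x z y"
    using Suc.prems(2,3) rewriting_ends[OF z(1)] path_iff_word ne W by auto
  then have "(move A S ^^ (n * m)) (pad A n y z) (pad A n y w)"
    using Suc.IH[OF z(2) _ ne] rewriting_length[OF z(1)] Suc.prems by simp
  moreover have "(move A S ^^ n) (pad A n y v) (pad A n y z)"
    using moves_of_rewriting[OF z(1) Suc.prems(2)] rewriting_length[OF z(1)] Suc.prems by simp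
  ultimately show ?case by (auto simp: relpowp_add)
qed simp

lemma num_den:
  assumes "a \<in> arrows A S"
  shows "num A a \<in> hom A (src A a) (apex A a)" "den A a \<in> hom A (tgt A a) (apex A a)"
    "den A a \<in> S"
  using assms by (auto simp: arrows_def apex_def hom_def S_mor S_idn cod_obj)

text \<open>The data needed for \<open>comp_of_fractions\<close>. For composition and for the identity rules \<open>p\<close>, \<open>q\<close> come
  from moving a denominator past a numerator one of which is an identity, and \<open>r\<close> is an identity.
  For \<open>s\<close> after its formal inverse, \<open>p\<close>, \<open>q\<close> cancel \<open>s\<close>. For the formal inverse after \<open>s\<close>, the result
  is \<open>s\<^bsup>-1\<^esup> s\<close>, which is the identity fraction expanded by \<open>r = s\<close>.\<close>

lemma rule_square:
  assumes "rule A S [b, a] [c]"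
  obtains P p q r where "p \<in> S" "p \<in> hom A (apex A b) P" "q \<in> hom A (apex A a) P"
    "r \<in> hom A (apex A c) P" "Comp A p (num A b) = Comp A q (den A a)"
    "Comp A p (den A b) = Comp A r (den A c)" "Comp A r (num A c) = Comp A q (num A a)"
proof -
  have ar: "a \<in> arrows A S" "b \<in> arrows A S" "c \<in> arrows A S" "src A b = tgt A a"
    "src A c = src A a" "tgt A c = tgt A b"
    using rule_arrows[OF assms] by auto
  have ob: "apex A a \<in> Obj A" "apex A b \<in> Obj A" "apex A c \<in> Obj A"
    using num_den(1)[THEN hom_obj] ar by auto
  note nd = num_den[OF ar(1)] num_den[OF ar(2)] num_den[OF ar(3)]
  note ids = idn_left[OF nd(1)] idn_right[OF nd(1)] idn_left[OF nd(2)] idn_right[OF nd(2)]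
    idn_left[OF nd(4)] idn_right[OF nd(4)] idn_left[OF nd(5)] idn_right[OF nd(5)]
    idn_left[OF nd(7)] idn_right[OF nd(7)] idn_left[OF nd(8)] idn_right[OF nd(8)]
  from assms show thesis
  proof cases
    case (rule_comp f g)
    then have "num A a = f" "num A b = g" "den A a = Idn A (tgt A a)" "den A b = Idn A (tgt A b)"
      "num A c = Comp A g f" "den A c = Idn A (tgt A c)" "apex A b = Cod A g" "apex A a = Cod A f"
      "apex A c = Cod A g"
      using comp_mor[of f g] by (auto simp: apex_def)
    then show thesis
      using that[of "Idn A (apex A b)" "apex A b" "num A b" "Idn A (apex A b)"] ob nd ids ar
        rule_comp S_idn idn_hom by auto
  next
    case rule_idl
    then show thesis
      using that[of "den A a" "apex A a" "Idn A (apex A a)" "Idn A (apex A a)"] ob nd ids ar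
       S_idn idn_hom by (auto simp: apex_def)
  next
    case rule_idr
    have x: "src A b \<in> Obj A" using ar arrow_ends_obj by blast
    have "num A a = Idn A (src A b)" "den A a = Idn A (src A b)" "apex A a = src A b" "c = b"
      using rule_idr x by (auto simp: apex_def)
    then show thesis
      using that[of "Idn A (apex A b)" "apex A b" "num A b" "Idn A (apex A b)"] ob nd ids
        S_idn idn_hom by simp
  next
    case (rule_inv_right s)
    then show thesis
      using that[of "Idn A (apex A b)" "apex A b" "Idn A (apex A a)" "Idn A (apex A c)"] ob nd ids ar
       S_idn idn_hom by (auto simp: apex_def)
  next
    case (rule_inv_left s)
    then show thesis
      using that[of "Idn A (apex A b)" "apex A b" "Idn A (apex A a)" s] ob nd ids ar
       S_idn idn_hom by (auto simp: apex_def)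
  qed
qed

end

section \<open>Evaluating families of words\<close>

text \<open>A family of words of one common length is stored as the list of its columns, each of which is a
  family of letters; \<open>row\<close> recovers the word at an index.\<close>

definition row :: "('i \<Rightarrow> 'm arrow) list \<Rightarrow> 'i \<Rightarrow> 'm arrow list" where
  "row W i = map (\<lambda>a. a i) W"

definition columns :: "nat \<Rightarrow> ('i \<Rightarrow> 'm arrow list) \<Rightarrow> ('i \<Rightarrow> 'm arrow) list" where
  "columns n w = map (\<lambda>k i. w i ! k) [0..<n]"

lemma row_simps [simp]:
  "row [] i = []" "row (a # W) i = a i # row W i" "row (V @ W) i = row V i @ row W i"
  "length (row W i) = length W" "row W i = [] \<longleftrightarrow> W = []"
  by (auto simp: row_def)

lemma length_columns [simp]: "length (columns n w) = n"
  by (simp add: columns_def)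

lemma row_columns: "length (w i) = n \<Longrightarrow> row (columns n w) i = w i"
  by (rule nth_equalityI) (auto simp: row_def columns_def)

locale inverting_functor = localizing_with_identities A S + D: category D
  for A :: "('o, 'm) cat" and S :: "'m set" and D :: "('p, 'n) cat" +
  fixes I :: "'i set" and F :: "('i \<Rightarrow> 'o, 'i \<Rightarrow> 'm, 'p, 'n) cfunctor"
  assumes F_functor: "is_functor (power_cat I A) D F"
    and F_inverts: "s \<in> I \<rightarrow>\<^sub>E S \<Longrightarrow> is_iso D (FMor F s)"
begin

abbreviation FO :: "('i \<Rightarrow> 'o) \<Rightarrow> 'p" where "FO X \<equiv> FObj F (restrict X I)"
abbreviation FM :: "('i \<Rightarrow> 'm) \<Rightarrow> 'n" where "FM f \<equiv> FMor F (restrict f I)"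

lemma F_hom:
  assumes "\<forall>i\<in>I. f i \<in> hom A (X i) (Y i)"
  shows "FM f \<in> hom D (FO X) (FO Y)"
proof (rule functorD(3)[OF F_functor])
  show "restrict f I \<in> hom (power_cat I A) (restrict X I) (restrict Y I)"
    using assms by (auto simp: hom_def restrict_eq_iff)
qed

lemma F_comp:
  assumes "\<forall>i\<in>I. f i \<in> hom A (X i) (Y i)" "\<forall>i\<in>I. g i \<in> hom A (Y i) (Z i)"
  shows "Comp D (FM g) (FM f) = FM (\<lambda>i. Comp A (g i) (f i))"
proof -
  have "restrict f I \<in> hom (power_cat I A) (restrict X I) (restrict Y I)"
    "restrict g I \<in> hom (power_cat I A) (restrict Y I) (restrict Z I)"
    using assms by (auto simp: hom_def restrict_eq_iff)
  from functorD(4)[OF F_functor this] show ?thesis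
    by (simp cong: restrict_cong)
qed

lemma FO_obj: "\<forall>i\<in>I. X i \<in> Obj A \<Longrightarrow> FO X \<in> Obj D"
  using functorD(1)[OF F_functor, of "restrict X I"] by simp

lemma F_idn:
  assumes "\<forall>i\<in>I. X i \<in> Obj A"
  shows "FM (\<lambda>i. Idn A (X i)) = Idn D (FO X)"
  using functorD(2)[OF F_functor, of "restrict X I"] assms by (simp cong: restrict_cong)

lemma F_inverse:
  assumes "\<forall>i\<in>I. s i \<in> S"
  shows "inverse_mor D (FM s) (SOME t. inverse_mor D (FM s) t)"
proof (rule someI_ex)
  show "\<exists>t. inverse_mor D (FM s) t"
    using F_inverts[of "restrict s I"] assms by (auto simp: is_iso_iff_inverse)
qed

lemma FO_cong: "\<forall>i\<in>I. X i = Y i \<Longrightarrow> FO X = FO Y"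
  by (simp cong: restrict_cong)

lemma FM_cong: "\<forall>i\<in>I. f i = g i \<Longrightarrow> FM f = FM g"
  by (simp cong: restrict_cong)

definition eval_column :: "('i \<Rightarrow> 'm arrow) \<Rightarrow> 'n" where
  "eval_column a = Comp D (SOME t. inverse_mor D (FM (\<lambda>i. den A (a i))) t) (FM (\<lambda>i. num A (a i)))"

primrec eval_columns :: "('i \<Rightarrow> 'o) \<Rightarrow> ('i \<Rightarrow> 'm arrow) list \<Rightarrow> 'n" where
  "eval_columns X [] = Idn D (FO X)"
| "eval_columns X (a # W) = Comp D (eval_column a) (eval_columns X W)"

lemma eval_column_cong: "\<forall>i\<in>I. a i = b i \<Longrightarrow> eval_column a = eval_column b"
  by (simp add: eval_column_def cong: restrict_cong)

lemma eval_cong: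
  assumes "length V = length W" "\<forall>i\<in>I. row V i = row W i" "\<forall>i\<in>I. X i = Y i"
  shows "eval_columns X V = eval_columns Y W"
  using assms(1,2)
proof (induction V W rule: list_induct2)
  case Nil
  then show ?case using FO_cong[OF assms(3)] by simp
next
  case (Cons a V b W)
  then have "eval_column a = eval_column b" by (intro eval_column_cong) simp
  then show ?case using Cons by simp
qed

lemma eval_column_parts:
  assumes "\<forall>i\<in>I. a i \<in> arrows A S"
  shows "FM (\<lambda>i. num A (a i)) \<in> hom D (FO (\<lambda>i. src A (a i))) (FO (\<lambda>i. apex A (a i)))"
    and "FM (\<lambda>i. den A (a i)) \<in> hom D (FO (\<lambda>i. tgt A (a i))) (FO (\<lambda>i. apex A (a i)))"
    and "inverse_mor D (FM (\<lambda>i. den A (a i))) (SOME t. inverse_mor D (FM (\<lambda>i. den A (a i))) t)"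
proof -
  show "FM (\<lambda>i. num A (a i)) \<in> hom D (FO (\<lambda>i. src A (a i))) (FO (\<lambda>i. apex A (a i)))"
    by (rule F_hom) (use assms num_den in blast)
  show "FM (\<lambda>i. den A (a i)) \<in> hom D (FO (\<lambda>i. tgt A (a i))) (FO (\<lambda>i. apex A (a i)))"
    by (rule F_hom) (use assms num_den in blast)
  show "inverse_mor D (FM (\<lambda>i. den A (a i))) (SOME t. inverse_mor D (FM (\<lambda>i. den A (a i))) t)"
    by (rule F_inverse) (use assms num_den in blast)
qed

lemma eval_column_hom:
  assumes "\<forall>i\<in>I. a i \<in> arrows A S \<and> src A (a i) = X i \<and> tgt A (a i) = Y i"
  shows "eval_column a \<in> hom D (FO X) (FO Y)"
proof -
  have ar: "\<forall>i\<in>I. a i \<in> arrows A S" using assms by blast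
  have "FO (\<lambda>i. src A (a i)) = FO X" "FO (\<lambda>i. tgt A (a i)) = FO Y"
    using assms by (auto intro: FO_cong)
  then show ?thesis
    using D.comp_hom[OF eval_column_parts(1)[OF ar] D.inverse_hom(1)[OF eval_column_parts(3,2)[OF ar]]]
    unfolding eval_column_def by metis
qed

lemma eval_column_Arr:
  assumes f: "\<forall>i\<in>I. f i \<in> Mor A"
  shows "eval_column (\<lambda>i. Arr (f i)) = FM f"
proof -
  have ar: "\<forall>i\<in>I. Arr (f i) \<in> arrows A S" using f by (auto simp: arrows_def)
  note p = eval_column_parts[OF ar, simplified]
  have o: "\<forall>i\<in>I. Cod A (f i) \<in> Obj A" using f cod_obj by blast
  have "(SOME t. inverse_mor D (FM (\<lambda>i. Idn A (Cod A (f i)))) t) = Idn D (FO (\<lambda>i. Cod A (f i)))"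
    using D.inverse_unique[OF p(3)] D.inverse_idn[OF FO_obj[OF o]] F_idn[OF o] by simp
  then show ?thesis using D.idn_left[OF p(1)] by (simp add: eval_column_def apex_def)
qed

lemma eval_column_idn:
  assumes "\<forall>i\<in>I. X i \<in> Obj A"
  shows "eval_column (\<lambda>i. Arr (Idn A (X i))) = Idn D (FO X)"
  using eval_column_Arr[of "\<lambda>i. Idn A (X i)"] F_idn[OF assms] assms by simp

text \<open>The rules may be of different kinds at different indices, because \<open>rule_square\<close> has the same form
  for all of them and the squares can be collected into squares in \<open>A\<^sup>I\<close>.\<close>

lemma eval_column_comp:
  assumes rules: "\<forall>i\<in>I. rule A S [b i, a i] [c i]"
  shows "Comp D (eval_column b) (eval_column a) = eval_column c"
proof -
  have ar: "\<forall>i\<in>I. b i \<in> arrows A S" "\<forall>i\<in>I. a i \<in> arrows A S" "\<forall>i\<in>I. c i \<in> arrows A S"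
    and ends: "\<forall>i\<in>I. src A (b i) = tgt A (a i)" "\<forall>i\<in>I. src A (c i) = src A (a i)"
      "\<forall>i\<in>I. tgt A (c i) = tgt A (b i)"
    using rule_arrows rules by blast+
  have "\<forall>i\<in>I. \<exists>z. case z of (P, p, q, r) \<Rightarrow> p \<in> S \<and> p \<in> hom A (apex A (b i)) P \<and>
      q \<in> hom A (apex A (a i)) P \<and> r \<in> hom A (apex A (c i)) P \<and>
      Comp A p (num A (b i)) = Comp A q (den A (a i)) \<and>
      Comp A p (den A (b i)) = Comp A r (den A (c i)) \<and>
      Comp A r (num A (c i)) = Comp A q (num A (a i))" (is "\<forall>i\<in>I. \<exists>z. ?sq i z")
  proof
    fix i assume "i \<in> I"
    then have "rule A S [b i, a i] [c i]" using rules by blast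
    then show "\<exists>z. ?sq i z" by (rule rule_square) auto
  qed
  from bchoice[OF this] obtain z where z: "\<forall>i\<in>I. ?sq i (z i)" by blast
  define P where "P i = fst (z i)" for i
  define p where "p i = fst (snd (z i))" for i
  define q where "q i = fst (snd (snd (z i)))" for i
  define r where "r i = snd (snd (snd (z i)))" for i
  have "z i = (P i, p i, q i, r i)" for i by (simp add: P_def p_def q_def r_def)
  then have sq: "\<forall>i\<in>I. p i \<in> S" "\<forall>i\<in>I. p i \<in> hom A (apex A (b i)) (P i)"
    "\<forall>i\<in>I. q i \<in> hom A (apex A (a i)) (P i)" "\<forall>i\<in>I. r i \<in> hom A (apex A (c i)) (P i)"
    "\<forall>i\<in>I. Comp A (p i) (num A (b i)) = Comp A (q i) (den A (a i))"
    "\<forall>i\<in>I. Comp A (p i) (den A (b i)) = Comp A (r i) (den A (c i))"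
    "\<forall>i\<in>I. Comp A (r i) (num A (c i)) = Comp A (q i) (num A (a i))"
    using z by auto
  have n: "\<forall>i\<in>I. num A (x i) \<in> hom A (src A (x i)) (apex A (x i))"
    and d: "\<forall>i\<in>I. den A (x i) \<in> hom A (tgt A (x i)) (apex A (x i))"
    if "\<forall>i\<in>I. x i \<in> arrows A S" for x :: "'i \<Rightarrow> 'm arrow"
    using num_den that by blast+
  note A = eval_column_parts[OF ar(2)] and B = eval_column_parts[OF ar(1)]
    and C = eval_column_parts[OF ar(3)]
  note eqs = FO_cong[OF ends(1)] FO_cong[OF ends(2)] FO_cong[OF ends(3)]
  have 1: "Comp D (FM p) (FM (\<lambda>i. num A (b i))) = Comp D (FM q) (FM (\<lambda>i. den A (a i)))"
    unfolding F_comp[OF n[OF ar(1)] sq(2)] F_comp[OF d[OF ar(2)] sq(3)] by (rule FM_cong[OF sq(5)])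
  have 2: "Comp D (FM p) (FM (\<lambda>i. den A (b i))) = Comp D (FM r) (FM (\<lambda>i. den A (c i)))"
    unfolding F_comp[OF d[OF ar(1)] sq(2)] F_comp[OF d[OF ar(3)] sq(4)] by (rule FM_cong[OF sq(6)])
  have 3: "Comp D (FM r) (FM (\<lambda>i. num A (c i))) = Comp D (FM q) (FM (\<lambda>i. num A (a i)))"
    unfolding F_comp[OF n[OF ar(3)] sq(4)] F_comp[OF n[OF ar(2)] sq(3)] by (rule FM_cong[OF sq(7)])
  show ?thesis unfolding eval_column_def
    by (rule D.comp_of_fractions[OF A B(1)[unfolded eqs] B(2,3) C(1)[unfolded eqs]
          C(2)[unfolded eqs] C(3) F_hom[OF sq(2)] F_inverse[OF sq(1)] F_hom[OF sq(3)]
          F_hom[OF sq(4)] 1 2 3])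
qed

text \<open>Inserting identities separates the indices in \<open>J\<close>, where the two letters are contracted, from the
  other ones: at an index in \<open>J\<close> the pair \<open>b a\<close> becomes \<open>id b a id\<close>, elsewhere \<open>b id id a\<close>. All the
  insertions, and the contraction of the middle pair, are columns of rules.\<close>

lemma eval_column_pair:
  assumes ar: "\<forall>i\<in>I. b i \<in> arrows A S \<and> a i \<in> arrows A S \<and> src A (b i) = tgt A (a i)"
    and J: "\<forall>i\<in>I. i \<in> J \<longrightarrow> rule A S [b i, a i] [c i]"
  shows "Comp D (eval_column b) (eval_column a) =
    Comp D (eval_column (\<lambda>i. if i \<in> J then Arr (Idn A (tgt A (c i))) else b i))
      (Comp D (eval_column (\<lambda>i. if i \<in> J then c i else Arr (Idn A (src A (b i)))))
        (eval_column (\<lambda>i. if i \<in> J then Arr (Idn A (src A (c i))) else a i)))"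
    (is "_ = Comp D (eval_column ?b') (Comp D (eval_column ?e) (eval_column ?a'))")
proof -
  let ?b = "\<lambda>i. if i \<in> J then b i else Arr (Idn A (src A (b i)))"
  let ?a = "\<lambda>i. if i \<in> J then a i else Arr (Idn A (tgt A (a i)))"
  have c: "\<forall>i\<in>I. i \<in> J \<longrightarrow> src A (c i) = src A (a i) \<and> tgt A (c i) = tgt A (b i) \<and>
      c i \<in> arrows A S"
    using rule_arrows J by blast
  have obs: "\<forall>i\<in>I. src A (b i) \<in> Obj A \<and> tgt A (b i) \<in> Obj A \<and> src A (a i) \<in> Obj A \<and>
      tgt A (a i) \<in> Obj A"
    using ar arrow_ends_obj by blast
  have idl: "rule A S [Arr (Idn A y), x] [x]" if "x \<in> arrows A S" "tgt A x = y" for x y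
    using rule_idl that by blast
  have idr: "rule A S [x, Arr (Idn A y)] [x]" if "x \<in> arrows A S" "src A x = y" for x y
    using rule_idr that by blast
  have b: "Comp D (eval_column ?b') (eval_column ?b) = eval_column b"
    by (rule eval_column_comp) (use ar c in \<open>auto intro: idl idr\<close>)
  have a: "Comp D (eval_column ?a) (eval_column ?a') = eval_column a"
    by (rule eval_column_comp) (use ar c in \<open>auto intro: idl idr\<close>)
  have e: "Comp D (eval_column ?b) (eval_column ?a) = eval_column ?e"
    by (rule eval_column_comp) (use J obs ar in \<open>auto intro: idl simp: idn_arrow\<close>)
  let ?W = "\<lambda>i. tgt A (?a' i)" and ?V = "\<lambda>i. src A (?b' i)" and ?Y = "\<lambda>i. tgt A (a i)"
  have ha': "eval_column ?a' \<in> hom D (FO (\<lambda>i. src A (a i))) (FO ?W)"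
    by (rule eval_column_hom) (use ar c obs in \<open>auto simp: idn_arrow\<close>)
  have ha: "eval_column ?a \<in> hom D (FO ?W) (FO ?Y)"
    by (rule eval_column_hom) (use ar c obs in \<open>auto simp: idn_arrow\<close>)
  have hb: "eval_column ?b \<in> hom D (FO ?Y) (FO ?V)"
    by (rule eval_column_hom) (use ar c obs in \<open>auto simp: idn_arrow\<close>)
  have hb': "eval_column ?b' \<in> hom D (FO ?V) (FO (\<lambda>i. tgt A (b i)))"
    by (rule eval_column_hom) (use ar c obs in \<open>auto simp: idn_arrow\<close>)
  have "Comp D (eval_column b) (eval_column a) =
      Comp D (eval_column ?b') (Comp D (eval_column ?b) (Comp D (eval_column ?a) (eval_column ?a')))"
    using D.comp_assoc[OF D.comp_hom[OF ha' ha] hb hb'] a b by simp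
  also have "Comp D (eval_column ?b) (Comp D (eval_column ?a) (eval_column ?a')) =
      Comp D (eval_column ?e) (eval_column ?a')"
    using D.comp_assoc[OF ha' ha hb] e by simp
  finally show ?thesis .
qed

text \<open>By \<open>eval_column_pair\<close>, the value depends only on the contraction at the indices that move.\<close>

lemma eval_column_pair_move:
  assumes ar: "\<forall>i\<in>I. b i \<in> arrows A S \<and> a i \<in> arrows A S \<and> src A (b i) = tgt A (a i)"
    and moves: "\<forall>i\<in>I. (b i = b' i \<and> a i = a' i) \<or>
      (\<exists>c. rule A S [b i, a i] [c] \<and> rule A S [b' i, a' i] [c])"
  shows "Comp D (eval_column b) (eval_column a) = Comp D (eval_column b') (eval_column a')"
proof -
  define J where "J = {i. \<exists>c. rule A S [b i, a i] [c] \<and> rule A S [b' i, a' i] [c]}"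
  have "\<forall>i\<in>J. \<exists>c. rule A S [b i, a i] [c] \<and> rule A S [b' i, a' i] [c]"
    by (simp add: J_def)
  then obtain c where c: "\<forall>i\<in>J. rule A S [b i, a i] [c i] \<and> rule A S [b' i, a' i] [c i]"
    by (auto dest: bchoice)
  have ar': "\<forall>i\<in>I. b' i \<in> arrows A S \<and> a' i \<in> arrows A S \<and> src A (b' i) = tgt A (a' i)"
    using ar moves rule_arrows by metis
  have nJ: "\<forall>i\<in>I. i \<notin> J \<longrightarrow> b i = b' i \<and> a i = a' i"
    using moves by (auto simp: J_def)
  have "eval_column (\<lambda>i. if i \<in> J then Arr (Idn A (tgt A (c i))) else b i) =
      eval_column (\<lambda>i. if i \<in> J then Arr (Idn A (tgt A (c i))) else b' i)"
    "eval_column (\<lambda>i. if i \<in> J then c i else Arr (Idn A (src A (b i)))) =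
      eval_column (\<lambda>i. if i \<in> J then c i else Arr (Idn A (src A (b' i))))"
    "eval_column (\<lambda>i. if i \<in> J then Arr (Idn A (src A (c i))) else a i) =
      eval_column (\<lambda>i. if i \<in> J then Arr (Idn A (src A (c i))) else a' i)"
    using nJ by (auto intro!: eval_column_cong)
  then show ?thesis
    using eval_column_pair[OF ar, of J c] eval_column_pair[OF ar', of J c] c by simp
qed

lemma eval_hom:
  assumes "\<forall>i\<in>I. path A S (X i) (row W i) (Y i)"
  shows "eval_columns X W \<in> hom D (FO X) (FO Y)"
  using assms
proof (induction W arbitrary: Y)
  case Nil
  then have "FO Y = FO X" "\<forall>i\<in>I. X i \<in> Obj A" by (auto intro: FO_cong)
  then show ?case using D.idn_hom[OF FO_obj[of X]] by (metis eval_columns.simps(1))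
next
  case (Cons a W)
  have "eval_columns X W \<in> hom D (FO X) (FO (\<lambda>i. src A (a i)))"
    by (rule Cons.IH) (use Cons.prems in simp)
  moreover have "eval_column a \<in> hom D (FO (\<lambda>i. src A (a i))) (FO Y)"
    using Cons.prems by (intro eval_column_hom) simp
  ultimately show ?case unfolding eval_columns.simps by (rule D.comp_hom)
qed

lemma eval_append:
  assumes "\<forall>i\<in>I. path A S (X i) (row W i) (Y i)" "\<forall>i\<in>I. path A S (Y i) (row V i) (Z i)"
  shows "eval_columns X (V @ W) = Comp D (eval_columns Y V) (eval_columns X W)"
  using assms(2)
proof (induction V arbitrary: Z)
  case Nil
  then show ?case using D.idn_left[OF eval_hom[OF assms(1)]] by simp
next
  case (Cons a V)
  then have V: "\<forall>i\<in>I. path A S (Y i) (row V i) (src A (a i))" by simp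
  have "eval_column a \<in> hom D (FO (\<lambda>i. src A (a i))) (FO Z)"
    using Cons.prems by (intro eval_column_hom) simp
  then show ?case
    using D.comp_assoc[OF eval_hom[OF assms(1)] eval_hom[OF V]] Cons.IH[OF V] by simp
qed

text \<open>The place of the move varies with the index. By induction on the length, first all moves that
  leave the first letter alone are made, then those at the first two letters; the latter happen in
  two fixed columns.\<close>

lemma eval_move:
  assumes "length V = length W" "\<forall>i\<in>I. move A S (row V i) (row W i)"
    "\<forall>i\<in>I. path A S (X i) (row V i) (Y i)"
  shows "eval_columns X V = eval_columns X W"
  using assms
proof (induction V arbitrary: W Y)
  case (Cons b V)
  then obtain b' W' where W': "W = b' # W'" "length V = length W'" by (cases W) auto
  \<comment> \<open>\<open>J\<close> collects the indices at which the first letter stays; \<open>Z\<close> has these moves made.\<close>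
  define J where "J = {i. b i = b' i \<and> move A S (row V i) (row W' i)}"
  have J: "\<exists>a a' u c. row V i = a # u \<and> row W' i = a' # u \<and> rule A S [b i, a] [c] \<and>
      rule A S [b' i, a'] [c]" if "i \<in> I" "i \<notin> J" for i
    using move_Cons_cases[of A S "b i" "row V i" "b' i" "row W' i"] Cons.prems(2) W'(1) that
    by (auto simp: J_def)
  define Z where "Z = columns (length V) (\<lambda>i. if i \<in> J then row W' i else row V i)"
  have Z: "row Z i = (if i \<in> J then row W' i else row V i)" for i
    unfolding Z_def by (rule row_columns) (simp add: W'(2))
  have lZ: "length Z = length V" by (simp add: Z_def)
  have V: "\<forall>i\<in>I. path A S (X i) (row V i) (src A (b i))" using Cons.prems by simp
  have mZ: "\<forall>i\<in>I. move A S (row V i) (row Z i)" by (auto simp: Z J_def move_refl)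
  have pZ: "\<forall>i\<in>I. path A S (X i) (row Z i) (src A (b i))"
    using V mZ move_path by blast
  have step: "eval_columns X V = eval_columns X Z"
    by (rule Cons.IH[OF _ mZ V]) (simp add: lZ)
  show ?case
  proof (cases Z)
    case Nil
    then have "V = []" "W' = []" using lZ W'(2) by auto
    then have "\<forall>i\<in>I. b i = b' i" using J by (auto simp: J_def)
    then show ?thesis using eval_column_cong[of b b'] \<open>V = []\<close> \<open>W' = []\<close> W'(1) by simp
  next
    case Z': (Cons a Z1)
    then obtain a' W1 where W: "W' = a' # W1" using lZ W'(2) by (cases W') auto
    have tails: "\<forall>i\<in>I. row Z1 i = row W1 i"
    proof
      fix i assume "i \<in> I"
      then show "row Z1 i = row W1 i" using Z[of i] J[of i] Z' W by (cases "i \<in> J") auto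
    qed
    have "length Z1 = length W1" using lZ W'(2) Z' W by simp
    then have e: "eval_columns X Z1 = eval_columns X W1" using tails by (intro eval_cong) auto
    have pair: "Comp D (eval_column b) (eval_column a) = Comp D (eval_column b') (eval_column a')"
    proof (rule eval_column_pair_move)
      show "\<forall>i\<in>I. b i \<in> arrows A S \<and> a i \<in> arrows A S \<and> src A (b i) = tgt A (a i)"
        using pZ Cons.prems(3) Z' by auto
      show "\<forall>i\<in>I. b i = b' i \<and> a i = a' i \<or>
          (\<exists>c. rule A S [b i, a i] [c] \<and> rule A S [b' i, a' i] [c])"
      proof
        fix i assume "i \<in> I"
        then show "b i = b' i \<and> a i = a' i \<or>
          (\<exists>c. rule A S [b i, a i] [c] \<and> rule A S [b' i, a' i] [c])"
          using Z[of i] J[of i] Z' W by (cases "i \<in> J") (auto simp: J_def)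
      qed
    qed
    have "\<forall>i\<in>I. path A S (X i) (row Z1 i) (src A (a i))" using pZ Z' by simp
    note h1 = eval_hom[OF this]
    have h2: "eval_column a \<in> hom D (FO (\<lambda>i. src A (a i))) (FO (\<lambda>i. src A (b i)))"
      using pZ Z' by (intro eval_column_hom) auto
    have h3: "eval_column b \<in> hom D (FO (\<lambda>i. src A (b i))) (FO Y)"
      using Cons.prems by (intro eval_column_hom) auto
    have pW: "\<forall>i\<in>I. path A S (X i) (row (b' # W') i) (Y i)"
      using Cons.prems W'(1) move_path by blast
    have h4: "eval_column a' \<in> hom D (FO (\<lambda>i. src A (a' i))) (FO (\<lambda>i. src A (b' i)))"
      using pW W by (intro eval_column_hom) auto
    have h5: "eval_column b' \<in> hom D (FO (\<lambda>i. src A (b' i))) (FO Y)"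
      using pW by (intro eval_column_hom) auto
    have "\<forall>i\<in>I. path A S (X i) (row W1 i) (src A (a' i))" using pW W by simp
    note h6 = eval_hom[OF this]
    show ?thesis
      using D.comp_assoc[OF h1 h2 h3] D.comp_assoc[OF h6 h4 h5] pair e step Z' W W'(1) by simp
  qed
qed simp

end

context inverting_functor
begin

lemma eval_moves:
  assumes "length V = length W" "\<forall>i\<in>I. (move A S ^^ k) (row V i) (row W i)"
    "\<forall>i\<in>I. path A S (X i) (row V i) (Y i)"
  shows "eval_columns X V = eval_columns X W"
  using assms
proof (induction k arbitrary: V)
  case 0
  then show ?case by (intro eval_cong) auto
next
  case (Suc k)
  have "\<forall>i\<in>I. \<exists>z. move A S (row V i) z \<and> (move A S ^^ k) z (row W i)"
    using Suc.prems(2) relpowp_Suc_D2 by metis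
  from bchoice[OF this] obtain z
    where z: "\<forall>i\<in>I. move A S (row V i) (z i) \<and> (move A S ^^ k) (z i) (row W i)" by blast
  define Z where "Z = columns (length V) z"
  have Z: "row Z i = z i" if "i \<in> I" for i
    unfolding Z_def using move_length[of A S "row V i" "z i"] z that by (intro row_columns) simp
  have "eval_columns X V = eval_columns X Z"
    by (rule eval_move[OF _ _ Suc.prems(3)]) (use z Z in \<open>auto simp: Z_def\<close>)
  also have "\<dots> = eval_columns X W"
  proof (rule Suc.IH)
    show "\<forall>i\<in>I. path A S (X i) (row Z i) (Y i)" using Z z Suc.prems(3) move_path by metis
  qed (use z Z Suc.prems(1) in \<open>auto simp: Z_def\<close>)
  finally show ?case .
qed

lemma eval_identity_columns:
  assumes "\<forall>i\<in>I. path A S (X i) (row W i) (Y i)"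
  shows "eval_columns X (replicate k (\<lambda>i. Arr (Idn A (Y i))) @ W) = eval_columns X W"
proof (induction k)
  case (Suc k)
  have "\<forall>i\<in>I. Y i \<in> Obj A" using assms path_obj by blast
  then show ?case using Suc D.idn_left[OF eval_hom[OF assms]] by (simp add: eval_column_idn)
qed simp

lemma row_replicate: "row (replicate k a) i = replicate k (a i)"
  by (simp add: row_def)

text \<open>The bound \<open>M\<close> has to be uniform in the index: it determines both how much padding leaves room for
  all intermediate words and how many parallel moves are made.\<close>

lemma eval_rewritings:
  assumes V: "V \<noteq> []" "\<forall>i\<in>I. path A S (X i) (row V i) (Y i)"
    and W: "\<forall>i\<in>I. path A S (X i) (row W i) (Y i)"
    and dist: "\<forall>i\<in>I. \<exists>m\<le>M. (row V i, row W i) \<in> rewriting A S ^^ m"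
  shows "eval_columns X V = eval_columns X W"
proof -
  define n where "n = length V + length W + M"
  let ?pad = "\<lambda>W. replicate (n - length W) (\<lambda>i. Arr (Idn A (Y i))) @ W"
  have pad: "row (?pad W) i = pad A n (Y i) (row W i)" for W i
    by (simp add: pad_def row_replicate)
  have "eval_columns X V = eval_columns X (?pad V)" using eval_identity_columns[OF V(2)] by simp
  also have "\<dots> = eval_columns X (?pad W)"
  proof (rule eval_moves)
    show "\<forall>i\<in>I. (move A S ^^ (n * M)) (row (?pad V) i) (row (?pad W) i)"
    proof
      fix i assume i: "i \<in> I"
      then obtain m where m: "m \<le> M" "(row V i, row W i) \<in> rewriting A S ^^ m"
        using dist by blast
      have "(move A S ^^ (n * m)) (row (?pad V) i) (row (?pad W) i)"
        unfolding pad by (rule moves_of_rewritings[OF m(2) V(2)[rule_format, OF i]])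
          (use m V in \<open>auto simp: n_def\<close>)
      then show "(move A S ^^ (n * M)) (row (?pad V) i) (row (?pad W) i)"
        by (rule moves_mono) (use m in simp)
    qed
    show "\<forall>i\<in>I. path A S (X i) (row (?pad V) i) (Y i)"
      unfolding pad using V pad_path by blast
  qed (simp add: n_def)
  also have "\<dots> = eval_columns X W" using eval_identity_columns[OF W] by simp
  finally show ?thesis .
qed

end

section \<open>Extending functors along the power of the localization\<close>

context localizing_with_identities
begin

text \<open>Padding does not change the class, so that short words can be brought to a common length.\<close>

lemma class_replicate_idn:
  assumes "P \<in> words A S"
  shows "replicate k (Arr (Idn A (word_tgt A P))) @ P \<in> words A S \<and>
    word_class A S (replicate k (Arr (Idn A (word_tgt A P))) @ P) = word_class A S P"
proof (induction k)
  case (Suc k)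
  let ?P = "replicate k (Arr (Idn A (word_tgt A P))) @ P"
  have o: "word_tgt A P \<in> Obj A" using assms word_ends_obj by blast
  have t: "word_tgt A ?P = word_tgt A P"
    using idn_word(3)[OF o] by (cases k) (auto simp: word_tgt_def)
  have "[Arr (Idn A (word_tgt A ?P))] @ ?P \<in> words A S"
    by (rule append_words) (use Suc o t in \<open>auto simp: idn_word\<close>)
  then show ?case using class_idn_left[of ?P] Suc t by simp
qed (use assms in simp)

end

text \<open>A family of classes is represented by columns, that is, by words of one common length.\<close>

definition represents ::
  "('o, 'm) cat \<Rightarrow> 'm set \<Rightarrow> 'i set \<Rightarrow> ('i \<Rightarrow> 'm arrow) list \<Rightarrow> ('i \<Rightarrow> 'm arrow list set) \<Rightarrow> bool" where
  "represents A S I W c \<longleftrightarrow>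
     W \<noteq> [] \<and> (\<forall>i\<in>I. row W i \<in> words A S \<and> word_class A S (row W i) = c i)"

lemma (in localizing_with_identities) represents_path:
  assumes "represents A S I W c"
  shows "\<forall>i\<in>I. path A S (Dom (localization A S) (c i)) (row W i) (Cod (localization A S) (c i))"
  using assms path_iff_word loc_dom loc_cod
  by (fastforce simp: represents_def)

locale bounded_localizing = localizing_with_identities A S
  for A :: "('o, 'm) cat" and S :: "'m set" +
  fixes N :: nat
  assumes short: "P \<in> words A S \<Longrightarrow>
      \<exists>R \<in> words A S. word_class A S R = word_class A S P \<and> length R \<le> N"
    and close: "\<exists>M. \<forall>P \<in> words A S. \<forall>R \<in> words A S. length P \<le> k \<longrightarrow> length R \<le> k \<longrightarrow>
      word_class A S P = word_class A S R \<longrightarrow> (\<exists>m\<le>M. (P, R) \<in> rewriting A S ^^ m)"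
begin

abbreviation L :: "('o, 'm arrow list set) cat" where
  "L \<equiv> localization A S"

abbreviation Q :: "('o, 'm, 'o, 'm arrow list set) cfunctor" where
  "Q \<equiv> localization_functor A S"

text \<open>Uniformly bounded lengths are essential: a family of words of unbounded lengths has no columns. The
  length \<open>Suc N\<close> is used because words are nonempty.\<close>

lemma represents_exists:
  assumes "\<forall>i\<in>I. c i \<in> Mor L"
  shows "\<exists>W. represents A S I W c"
proof -
  have "\<forall>i\<in>I. \<exists>P. P \<in> words A S \<and> word_class A S P = c i \<and> length P = Suc N"
  proof
    fix i assume "i \<in> I"
    then obtain P where P: "P \<in> words A S" "word_class A S P = c i"
      using assms by (auto simp: localization_def word_class_def elim!: quotientE)
    then obtain P' where P': "P' \<in> words A S" "word_class A S P' = c i" "length P' \<le> N"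
      using short by metis
    then show "\<exists>P. P \<in> words A S \<and> word_class A S P = c i \<and> length P = Suc N"
      using class_replicate_idn[OF P'(1), of "Suc N - length P'"]
      by (intro exI[of _ "replicate (Suc N - length P') (Arr (Idn A (word_tgt A P'))) @ P'"]) auto
  qed
  from bchoice[OF this] obtain P
    where P: "\<forall>i\<in>I. P i \<in> words A S \<and> word_class A S (P i) = c i \<and> length (P i) = Suc N" by blast
  have "columns (Suc N) P \<noteq> []" by (metis Zero_not_Suc length_columns list.size(3))
  then show ?thesis using P row_columns[of P _ "Suc N"] unfolding represents_def by metis
qed

text \<open>Half of the universal property of a localization, for \<open>L\<^sup>I\<close> under \<open>A\<^sup>I\<close>: existence of the factorization. A
  family of classes is sent to the value of any columns representing it; representing columns
  rewrite into each other within a uniform number of steps, so the choice does not matter.\<close>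

theorem functor_extends_along_power:
  assumes "category D" and "is_functor (power_cat I A) D F"
    and "\<And>s. s \<in> I \<rightarrow>\<^sub>E S \<Longrightarrow> is_iso D (FMor F s)"
  obtains G where "is_functor (power_cat I L) D G" "\<And>X. FObj G X = FObj F X"
    "\<And>f. f \<in> I \<rightarrow>\<^sub>E Mor A \<Longrightarrow> FMor G (FMor (power_functor I Q) f) = FMor F f"
proof -
  interpret D: category D by fact
  interpret inverting_functor A S D I F by unfold_locales (use assms in auto)
  have L: "category L" by (rule localization_category)
  have eq: "eval_columns (\<lambda>i. Dom L (c i)) V = eval_columns (\<lambda>i. Dom L (c i)) W"
    if V: "represents A S I V c" and W: "represents A S I W c" for V W c
  proof -
    obtain M where M: "\<forall>P \<in> words A S. \<forall>Q \<in> words A S. length P \<le> length V + length W \<longrightarrow>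
      length Q \<le> length V + length W \<longrightarrow> word_class A S P = word_class A S Q \<longrightarrow>
      (\<exists>m\<le>M. (P, Q) \<in> rewriting A S ^^ m)" using close by blast
    show ?thesis
    proof (rule eval_rewritings[OF _ represents_path[OF V] represents_path[OF W]])
      show "\<forall>i\<in>I. \<exists>m\<le>M. (row V i, row W i) \<in> rewriting A S ^^ m"
      proof
        fix i assume "i \<in> I"
        then show "\<exists>m\<le>M. (row V i, row W i) \<in> rewriting A S ^^ m"
          using V W by (intro M[rule_format]) (auto simp: represents_def)
      qed
    qed (use V in \<open>simp add: represents_def\<close>)
  qed
  define G where "G = \<lparr>FObj = FObj F,
    FMor = (\<lambda>c. eval_columns (\<lambda>i. Dom L (c i)) (SOME W. represents A S I W c))\<rparr>"
  have G: "FMor G c = eval_columns (\<lambda>i. Dom L (c i)) W" if "represents A S I W c" for W c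
    unfolding G_def using eq[OF someI[of "\<lambda>W. represents A S I W c", OF that] that] by simp
  have GQ: "FMor G (FMor (power_functor I Q) f) = FMor F f" if f: "f \<in> I \<rightarrow>\<^sub>E Mor A" for f
  proof -
    have w: "\<forall>i\<in>I. [Arr (f i)] \<in> words A S" using f by (auto simp: words_def arrows_def)
    let ?c = "FMor (power_functor I Q) f"
    have r: "represents A S I [\<lambda>i. Arr (f i)] ?c"
      using w by (auto simp: represents_def localization_functor_def)
    have p: "\<forall>i\<in>I. path A S (Dom L (?c i)) (row [\<lambda>i. Arr (f i)] i) (Cod L (?c i))"
      by (rule represents_path[OF r])
    then have "eval_column (\<lambda>i. Arr (f i)) \<in> hom D (FO (\<lambda>i. Dom L (?c i))) (FO (\<lambda>i. Cod L (?c i)))"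
      by (intro eval_column_hom) simp
    then have "eval_columns (\<lambda>i. Dom L (?c i)) [\<lambda>i. Arr (f i)] = eval_column (\<lambda>i. Arr (f i))"
      using D.idn_right by simp
    also have "\<dots> = FMor F f" using eval_column_Arr[of f] f by auto
    finally show ?thesis using G[OF r] by simp
  qed
  have "is_functor (power_cat I L) D G"
    unfolding is_functor_def
  proof (intro conjI ballI impI)
    fix X assume X: "X \<in> Obj (power_cat I L)"
    then have X': "X \<in> Obj (power_cat I A)" by (simp add: loc_obj)
    show "FObj G X \<in> Obj D" using functorD(1)[OF F_functor X'] by (simp add: G_def)
    have "Idn (power_cat I L) X = FMor (power_functor I Q) (Idn (power_cat I A) X)"
      using X by (auto simp: restrict_eq_iff loc_idn localization_functor_def)
    then show "FMor G (Idn (power_cat I L) X) = Idn D (FObj G X)"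
      using GQ[of "Idn (power_cat I A) X"] functorD(2)[OF F_functor X'] X'
      by (auto simp: G_def PiE_iff)
  next
    fix c assume "c \<in> Mor (power_cat I L)"
    then obtain W where W: "represents A S I W c"
      using represents_exists[of I c] by (auto simp: PiE_iff)
    show "FMor G c \<in> hom D (FObj G (Dom (power_cat I L) c)) (FObj G (Cod (power_cat I L) c))"
      unfolding G[OF W] using eval_hom[OF represents_path[OF W]] by (simp add: G_def)
  next
    fix c d assume c: "c \<in> Mor (power_cat I L)" and d: "d \<in> Mor (power_cat I L)"
      and cd: "Cod (power_cat I L) c = Dom (power_cat I L) d"
    obtain V W where W: "represents A S I W c" and V: "represents A S I V d"
      using c d represents_exists[of I c] represents_exists[of I d] by (auto simp: PiE_iff)
    have e: "\<forall>i\<in>I. Cod L (c i) = Dom L (d i)" using cd by (simp add: restrict_eq_iff)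
    have ends: "word_src A (row V i) = word_tgt A (row W i)" "row V i \<in> words A S"
      "row W i \<in> words A S" if "i \<in> I" for i
      using V W e that loc_dom loc_cod unfolding represents_def by metis+
    have VW: "represents A S I (V @ W) (Comp (power_cat I L) d c)"
      using V W append_words ends loc_comp[symmetric, OF ends(2,3,1)]
      by (auto simp: represents_def)
    have dom: "\<forall>i\<in>I. Dom L (Comp (power_cat I L) d c i) = Dom L (c i)"
      using category.comp_mor(2)[OF L] c d e by (auto simp: PiE_iff)
    have "FMor G (Comp (power_cat I L) d c) = eval_columns (\<lambda>i. Dom L (c i)) (V @ W)"
      unfolding G[OF VW] using dom by (intro eval_cong) auto
    also have "\<dots> = Comp D (eval_columns (\<lambda>i. Cod L (c i)) V) (eval_columns (\<lambda>i. Dom L (c i)) W)"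
      using represents_path[OF W] represents_path[OF V] e by (intro eval_append) auto
    also have "eval_columns (\<lambda>i. Cod L (c i)) V = eval_columns (\<lambda>i. Dom L (d i)) V"
      using e by (intro eval_cong) auto
    finally show "FMor G (Comp (power_cat I L) d c) = Comp D (FMor G d) (FMor G c)"
      unfolding G[OF W] G[OF V] .
  qed
  then show thesis
  proof (rule that)
    show "FObj G X = FObj F X" for X by (simp add: G_def)
  qed (rule GQ)
qed

end

section \<open>Generation by fractions\<close>

text \<open>The morphisms obtained by composing images under \<open>Q\<close> and inverses of images of \<open>S\<close>. Naturality
  statements are transported from \<open>A\<close> to \<open>L\<close> by induction on this predicate.\<close>

inductive fraction ::
  "('o, 'm) cat \<Rightarrow> 'm set \<Rightarrow> ('p, 'n) cat \<Rightarrow> ('o, 'm, 'p, 'n) cfunctor \<Rightarrow> 'n \<Rightarrow> bool"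
  for A S L Q where
  fraction_image: "f \<in> Mor A \<Longrightarrow> fraction A S L Q (FMor Q f)"
| fraction_inverse: "s \<in> S \<Longrightarrow> inverse_mor L (FMor Q s) t \<Longrightarrow> fraction A S L Q t"
| fraction_comp: "fraction A S L Q c \<Longrightarrow> fraction A S L Q d \<Longrightarrow> c \<in> Mor L \<Longrightarrow> d \<in> Mor L \<Longrightarrow>
    Cod L c = Dom L d \<Longrightarrow> fraction A S L Q (Comp L d c)"

lemma fraction_opposite:
  "fraction A S L Q c \<Longrightarrow> fraction (opposite A) S (opposite L) Q c"
proof (induction rule: fraction.induct)
  case (fraction_comp c d)
  then show ?case
    using fraction.fraction_comp[of "opposite A" S "opposite L" Q d c] by simp
qed (auto intro: fraction.intros)

context localizing_with_identities
begin

lemma class_rule: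
  assumes "rule A S p q" "p \<in> words A S" "q \<in> words A S"
  shows "word_class A S p = word_class A S q"
proof (rule rewriting_class)
  show "(p, q) \<in> rewriting A S" unfolding rewriting_def
    by (intro CollectI exI[of _ "[]"] exI[of _ p] exI[of _ q]) (use assms in simp)
qed

lemma class_cons:
  assumes "a # w \<in> words A S" "w \<noteq> []"
  shows "[a] \<in> words A S" "w \<in> words A S"
    "word_class A S (a # w) = Comp (localization A S) (word_class A S [a]) (word_class A S w)"
    "Cod (localization A S) (word_class A S w) = Dom (localization A S) (word_class A S [a])"
  using words_append[of "[a]" w A S] loc_comp[of "[a]" w] loc_dom loc_cod assms by auto

lemma class_Bar_inverse:
  assumes "s \<in> S"
  shows "inverse_mor (localization A S) (word_class A S [Arr s]) (word_class A S [Bar s])"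
proof -
  have m: "s \<in> Mor A" "Dom A s \<in> Obj A" "Cod A s \<in> Obj A"
    using assms S_mor dom_obj cod_obj by auto
  have w: "[Arr s] \<in> words A S" "[Bar s] \<in> words A S" "[Bar s, Arr s] \<in> words A S"
    "[Arr s, Bar s] \<in> words A S" using assms m by (auto simp: words_def arrows_def)
  show ?thesis
    using class_cons[OF w(3)] class_cons[OF w(4)] loc_mor[OF w(1)] loc_mor[OF w(2)]
      class_rule[OF rule_inv_left[OF assms] w(3)] class_rule[OF rule_inv_right[OF assms] w(4)]
      idn_word m loc_dom loc_cod w
    by (auto simp: inverse_mor_def hom_def loc_idn word_src_def word_tgt_def)
qed

text \<open>Splitting every letter into its denominator and numerator gives columns of one kind each, that is,
  families in \<open>S\<^sup>I\<close> and in \<open>A\<^sup>I\<close>.\<close>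

lemma class_num_den:
  assumes "a \<in> arrows A S"
  shows "word_class A S [a] = Comp (localization A S) (word_class A S [Bar (den A a)])
    (word_class A S [Arr (num A a)])"
    "[Bar (den A a), Arr (num A a)] \<in> words A S"
proof -
  note nd = num_den[OF assms]
  have o: "src A a \<in> Obj A" "tgt A a \<in> Obj A" using assms arrow_ends_obj by auto
  show w: "[Bar (den A a), Arr (num A a)] \<in> words A S"
    using nd by (auto simp: words_def arrows_def hom_def)
  have "word_class A S [a] = word_class A S [Bar (den A a), Arr (num A a)]"
  proof (cases a)
    case (Arr f)
    let ?i = "Idn A (Cod A f)"
    have i: "?i \<in> S" "Cod A f \<in> Obj A" using S_idn o Arr by auto
    have f: "f \<in> Mor A" using assms Arr by (auto simp: arrows_def)
    have w': "[Bar ?i] \<in> words A S" "[Arr ?i, Bar ?i] \<in> words A S" "[Arr ?i] \<in> words A S"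
      "[Arr f] \<in> words A S" "[Arr ?i, Arr f] \<in> words A S"
      using i f by (auto simp: words_def arrows_def)
    have "word_class A S [Bar ?i] = word_class A S [Arr ?i, Bar ?i]"
      using class_rule[OF _ w'(2,1)] rule_idl[of "Bar ?i" A S] i by (auto simp: arrows_def)
    also have "\<dots> = word_class A S [Arr ?i]"
      using class_rule[OF _ w'(2,3)] rule_inv_right[OF i(1), of A] i by simp
    finally have "word_class A S [Bar ?i, Arr f] = word_class A S [Arr ?i, Arr f]"
      using class_cons[OF w'(5)] class_cons[OF w] Arr by simp
    then show ?thesis
      using class_rule[OF _ w'(5,4)] rule_idl[of "Arr f" A S] f Arr by (auto simp: arrows_def)
  next
    case (Bar s)
    then have w': "[Bar s] \<in> words A S" "[Bar s, Arr (Idn A (Cod A s))] \<in> words A S"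
      using w assms by (auto simp: words_def)
    show ?thesis using class_rule[OF _ w'(2,1)] rule_idr[OF assms] Bar by simp
  qed
  then show "word_class A S [a] = Comp (localization A S) (word_class A S [Bar (den A a)])
    (word_class A S [Arr (num A a)])" using class_cons(3)[OF w] by simp
qed

lemma localization_fraction:
  assumes "c \<in> Mor (localization A S)"
  shows "fraction A S (localization A S) (localization_functor A S) c"
proof -
  obtain P where P: "P \<in> words A S" "c = word_class A S P"
    using assms by (auto simp: localization_def word_class_def elim!: quotientE)
  let ?fr' = "fraction A S (localization A S) (localization_functor A S)"
  have "?fr' (word_class A S P)" (is "?fr P")
    using P(1)
  proof (induction P)
    case (Cons a w)
    have a: "?fr [a]"
    proof (cases a)
      case (Arr f)
      then have "f \<in> Mor A" using Cons.prems by (auto simp: words_def arrows_def)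
      then have "?fr' (FMor (localization_functor A S) f)" by (rule fraction_image)
      then show ?thesis by (simp add: Arr localization_functor_def)
    next
      case (Bar s)
      then have s: "s \<in> S" using Cons.prems by (auto simp: words_def arrows_def)
      show ?thesis unfolding Bar
        by (rule fraction_inverse[OF s])
          (use class_Bar_inverse[OF s] in \<open>simp add: localization_functor_def\<close>)
    qed
    show ?case
    proof (cases "w = []")
      case False
      note c = class_cons[OF Cons.prems False]
      show ?thesis unfolding c(3)
        by (rule fraction_comp) (use a c Cons.IH loc_mor in auto)
    qed (use a in simp)
  qed (simp add: words_def)
  then show ?thesis using P by simp
qed

end

context bounded_localizing
begin

lemma power_localization_fraction:
  assumes "c \<in> Mor (power_cat I L)"
  shows "fraction (power_cat I A) (I \<rightarrow>\<^sub>E S) (power_cat I L) (power_functor I Q) c"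
proof -
  let ?fr = "fraction (power_cat I A) (I \<rightarrow>\<^sub>E S) (power_cat I L) (power_functor I Q)"
  let ?cl = "\<lambda>W. \<lambda>i\<in>I. word_class A S (row W i)"
  have m: "?cl W \<in> Mor (power_cat I L)" if "\<forall>i\<in>I. row W i \<in> words A S" for W
    using that loc_mor by auto
  have fr: "?fr (?cl W)" if "W \<noteq> []" "\<forall>i\<in>I. row W i \<in> words A S" for W
    using that
  proof (induction W)
    case (Cons a W)
    have ar: "\<forall>i\<in>I. a i \<in> arrows A S" using Cons.prems by (auto simp: words_def)
    let ?n = "\<lambda>i\<in>I. num A (a i)" and ?d = "\<lambda>i\<in>I. den A (a i)"
    let ?t = "\<lambda>i\<in>I. word_class A S [Bar (den A (a i))]"
    have nd: "\<forall>i\<in>I. num A (a i) \<in> Mor A" "\<forall>i\<in>I. den A (a i) \<in> S"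
      using num_den ar by (auto simp: hom_def)
    have n: "?fr (FMor (power_functor I Q) ?n)" using nd by (intro fraction_image) auto
    have inv: "inverse_mor (power_cat I L) (FMor (power_functor I Q) ?d) ?t"
    proof (subst inverse_mor_power)
      show "\<forall>i\<in>I. inverse_mor L (FMor (power_functor I Q) ?d i) (?t i)"
        using class_Bar_inverse nd by (simp add: localization_functor_def)
      show "FMor (power_functor I Q) ?d \<in> I \<rightarrow>\<^sub>E Mor L"
        using class_Bar_inverse nd by (auto simp: localization_functor_def inverse_mor_def)
    qed simp
    have d: "?fr ?t" by (rule fraction_inverse[OF _ inv]) (use nd in auto)
    have w: "\<forall>i\<in>I. [Bar (den A (a i))] \<in> words A S \<and> [Arr (num A (a i))] \<in> words A S \<and>
      Cod L (word_class A S [Arr (num A (a i))]) = Dom L (word_class A S [Bar (den A (a i))])"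
      using class_num_den(2) class_cons ar by (metis list.distinct(1))
    have "?fr (Comp (power_cat I L) ?t (FMor (power_functor I Q) ?n))"
      by (rule fraction_comp[OF n d])
        (use w loc_mor in \<open>auto simp: localization_functor_def restrict_eq_iff\<close>)
    also have "Comp (power_cat I L) ?t (FMor (power_functor I Q) ?n) = ?cl [a]"
      using class_num_den(1) ar by (auto simp: restrict_eq_iff localization_functor_def)
    finally have a: "?fr (?cl [a])" .
    show ?case
    proof (cases "W = []")
      case False
      have c: "\<forall>i\<in>I. [a i] \<in> words A S \<and> row W i \<in> words A S \<and>
        word_class A S (row (a # W) i) =
          Comp L (word_class A S [a i]) (word_class A S (row W i)) \<and>
        Cod L (word_class A S (row W i)) = Dom L (word_class A S [a i])"
        using class_cons Cons.prems False by (metis row_simps(2,5))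
      have "?fr (?cl W)" by (rule Cons.IH[OF False]) (use c in blast)
      then have "?fr (Comp (power_cat I L) (?cl [a]) (?cl W))"
        by (rule fraction_comp[OF _ a]) (use c loc_mor in \<open>auto simp: restrict_eq_iff\<close>)
      also have "Comp (power_cat I L) (?cl [a]) (?cl W) = ?cl (a # W)"
        using c by (auto simp: restrict_eq_iff)
      finally show ?thesis .
    next
      case True
      then show ?thesis using a by metis
    qed
  qed simp
  obtain W where W: "represents A S I W c" using represents_exists[of I c] assms by (auto simp: PiE_iff)
  have "c = ?cl W" using W assms by (auto simp: represents_def fun_eq_iff PiE_def extensional_def)
  then show ?thesis using fr[of W] W by (simp add: represents_def)
qed

end

section \<open>Coproducts\<close>

lemma is_coproduct_cong:
  assumes "\<forall>i\<in>I. X i = Y i" "\<forall>i\<in>I. inc i = inc' i"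
  shows "is_coproduct C I X K inc \<longleftrightarrow> is_coproduct C I Y K inc'"
  using assms unfolding is_coproduct_def by simp

lemma is_coproductD:
  assumes "is_coproduct C I X K inc"
  shows "K \<in> Obj C" and "i \<in> I \<Longrightarrow> inc i \<in> hom C (X i) K" and "i \<in> I \<Longrightarrow> X i \<in> Obj C"
    and "Z \<in> Obj C \<Longrightarrow> \<forall>i\<in>I. f i \<in> hom C (X i) Z \<Longrightarrow>
      \<exists>!h. h \<in> hom C K Z \<and> (\<forall>i\<in>I. Comp C h (inc i) = f i)"
  using assms unfolding is_coproduct_def by blast+

context category
begin

lemma coproduct_ext:
  assumes "is_coproduct C I X K inc" "h \<in> hom C K Z" "h' \<in> hom C K Z"
    and "\<forall>i\<in>I. Comp C h (inc i) = Comp C h' (inc i)"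
  shows "h = h'"
proof -
  note c = is_coproductD[OF assms(1)]
  have "Z \<in> Obj C" using hom_obj assms by blast
  moreover have "\<forall>i\<in>I. Comp C h (inc i) \<in> hom C (X i) Z"
    using comp_hom[OF c(2) assms(2)] by blast
  ultimately have "\<exists>!k. k \<in> hom C K Z \<and> (\<forall>i\<in>I. Comp C k (inc i) = Comp C h (inc i))"
    by (rule c(4))
  then show ?thesis using assms by metis
qed

lemma coproduct_map:
  assumes "is_coproduct C I X K inc" "is_coproduct C I Y K' inc'"
    and s: "\<forall>i\<in>I. s i \<in> hom C (X i) (Y i)"
  shows "coproduct_map C I K inc K' inc' s \<in> hom C K K'"
    and "\<forall>i\<in>I. Comp C (coproduct_map C I K inc K' inc' s) (inc i) = Comp C (inc' i) (s i)"
proof -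
  note c = is_coproductD[OF assms(1)] and c' = is_coproductD[OF assms(2)]
  have "\<forall>i\<in>I. Comp C (inc' i) (s i) \<in> hom C (X i) K'"
    using comp_hom c'(2) s by blast
  from theI'[OF c(4)[OF c'(1) this]]
  show "coproduct_map C I K inc K' inc' s \<in> hom C K K'"
    "\<forall>i\<in>I. Comp C (coproduct_map C I K inc K' inc' s) (inc i) = Comp C (inc' i) (s i)"
    unfolding coproduct_map_def by blast+
qed

lemma coproduct_unique:
  assumes K: "is_coproduct C I X K inc" and K': "is_coproduct C I X K' inc'"
  obtains f g where "f \<in> hom C K K'" "inverse_mor C f g" "\<forall>i\<in>I. Comp C f (inc i) = inc' i"
proof -
  note c = is_coproductD[OF K] and c' = is_coproductD[OF K']
  obtain f where f: "f \<in> hom C K K'" "\<forall>i\<in>I. Comp C f (inc i) = inc' i"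
    using c(4)[OF c'(1), of inc'] c'(2) by blast
  obtain g where g: "g \<in> hom C K' K" "\<forall>i\<in>I. Comp C g (inc' i) = inc i"
    using c'(4)[OF c(1), of inc] c(2) by blast
  have "Comp C g f = Idn C K"
    by (rule coproduct_ext[OF K comp_hom[OF f(1) g(1)] idn_hom[OF c(1)]])
      (use comp_assoc[OF c(2) f(1) g(1)] idn_left[OF c(2)] f g in auto)
  moreover have "Comp C f g = Idn C K'"
    by (rule coproduct_ext[OF K' comp_hom[OF g(1) f(1)] idn_hom[OF c'(1)]])
      (use comp_assoc[OF c'(2) g(1) f(1)] idn_left[OF c'(2)] f g in auto)
  ultimately have "inverse_mor C f g" using f(1) g(1) by (auto simp: inverse_mor_def hom_def)
  then show thesis using that f by blast
qed

text \<open>Preservation concerns all coproducts in \<open>A\<close>, whereas closure of \<open>S\<close> provides chosen ones; this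
  passes from the chosen ones to the others.\<close>

lemma coproduct_transfer:
  assumes K: "is_coproduct C I X K inc" and f: "f \<in> hom C K K'" "inverse_mor C f g"
  shows "is_coproduct C I X K' (\<lambda>i. Comp C f (inc i))"
  unfolding is_coproduct_def
proof (intro conjI ballI allI impI)
  note c = is_coproductD[OF K] and g = inverse_hom[OF f(2,1)]
  show "K' \<in> Obj C" using hom_obj f by blast
  show "X i \<in> Obj C" "Comp C f (inc i) \<in> hom C (X i) K'" if "i \<in> I" for i
    using that c(3) comp_hom[OF c(2) f(1)] by auto
  fix Z k assume Z: "Z \<in> Obj C" and k: "\<forall>i\<in>I. k i \<in> hom C (X i) Z"
  obtain h where h: "h \<in> hom C K Z" "\<forall>i\<in>I. Comp C h (inc i) = k i"
    using c(4)[OF Z k] by blast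
  show "\<exists>!h. h \<in> hom C K' Z \<and> (\<forall>i\<in>I. Comp C h (Comp C f (inc i)) = k i)"
  proof (intro ex1I[of _ "Comp C h g"] conjI ballI)
    show hg: "Comp C h g \<in> hom C K' Z" by (rule comp_hom[OF g(1) h(1)])
    have "Comp C (Comp C h g) f = h"
      using comp_assoc[OF f(1) g(1) h(1)] g(2) idn_right[OF h(1)] by simp
    then show "Comp C (Comp C h g) (Comp C f (inc i)) = k i" if "i \<in> I" for i
      using comp_assoc[OF c(2)[OF that] f(1) hg] h that by simp
    fix h' assume h': "h' \<in> hom C K' Z \<and> (\<forall>i\<in>I. Comp C h' (Comp C f (inc i)) = k i)"
    have "Comp C h' f = h"
      by (rule coproduct_ext[OF K comp_hom[OF f(1)] h(1)])
        (use h h' comp_assoc[OF c(2) f(1)] in auto)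
    then show "h' = Comp C h g"
      using comp_assoc[OF g(1) f(1), of h' Z] g(3) idn_right[of h' K' Z] h' by simp
  qed
qed

text \<open>With \<open>square_comp\<close>, this extends naturality of \<open>j\<close> from generators to all fractions.\<close>

lemma square_inverse:
  assumes "s \<in> hom C K K'" "inverse_mor C s s'" "t \<in> hom C X X'" "inverse_mor C t t'"
    and "j \<in> hom C X K" "j' \<in> hom C X' K'" and sq: "Comp C s j = Comp C j' t"
  shows "Comp C s' j' = Comp C j t'"
proof (rule inverse_cancel[OF assms(2,1)])
  note s' = inverse_hom[OF assms(2,1)] and t' = inverse_hom[OF assms(4,3)]
  show "Comp C s' j' \<in> hom C X' K" "Comp C j t' \<in> hom C X' K"
    using comp_hom s'(1) t'(1) assms by blast+
  have "Comp C s (Comp C j t') = Comp C (Comp C j' t) t'"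
    using comp_assoc[OF t'(1) assms(5,1)] sq by simp
  also have "\<dots> = j'" using comp_assoc[OF t'(1) assms(3,6)] t'(3) idn_right[OF assms(6)] by simp
  finally show "Comp C s (Comp C s' j') = Comp C s (Comp C j t')"
    using cancel_inner[OF assms(2,1,6)] by simp
qed

lemma square_comp:
  assumes "s \<in> hom C K K'" "s' \<in> hom C K' K''" "t \<in> hom C X X'" "t' \<in> hom C X' X''"
    and "j \<in> hom C X K" "j' \<in> hom C X' K'" "j'' \<in> hom C X'' K''"
    and "Comp C s j = Comp C j' t" "Comp C s' j' = Comp C j'' t'"
  shows "Comp C (Comp C s' s) j = Comp C j'' (Comp C t' t)"
  using comp_assoc[OF assms(5,1,2)] comp_assoc[OF assms(3,6,2)] comp_assoc[OF assms(3,4,7)]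
    assms(8,9) by simp

end

text \<open>The extension \<open>G\<close> of the coproduct functor is left adjoint to the diagonal of \<open>L\<close>, with unit
  given by the inclusions and counit by the codiagonals. The mediating morphism for a family \<open>f\<close>
  with target \<open>Z\<close> is the codiagonal of \<open>Z\<close> after \<open>G f\<close>; naturality of the inclusions shows that it
  restricts to \<open>f\<close>, and naturality of the codiagonal that it is the only such morphism. The
  categories \<open>A\<close>, \<open>L\<close> are abstract here, and the hypotheses self-dual apart from closure.\<close>

theorem coproducts_of_power_localization:
  assumes A: "category A" and L: "category L" and Q: "is_functor A L Q"
    and QO: "\<And>X. FObj Q X = X" and OL: "Obj L = Obj A"
    and inverts: "\<And>s. s \<in> S \<Longrightarrow> is_iso L (FMor Q s)"
    and generated: "\<And>c. c \<in> Mor L \<Longrightarrow> fraction A S L Q c"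
    and power_generated: "\<And>c. c \<in> Mor (power_cat I L) \<Longrightarrow>
      fraction (power_cat I A) (I \<rightarrow>\<^sub>E S) (power_cat I L) (power_functor I Q) c"
    and extension: "\<And>F. is_functor (power_cat I A) L F \<Longrightarrow>
      (\<And>s. s \<in> I \<rightarrow>\<^sub>E S \<Longrightarrow> is_iso L (FMor F s)) \<Longrightarrow>
      \<exists>G. is_functor (power_cat I L) L G \<and> (\<forall>X. FObj G X = FObj F X) \<and>
        (\<forall>f \<in> I \<rightarrow>\<^sub>E Mor A. FMor G (FMor (power_functor I Q) f) = FMor F f)"
    and SA: "S \<subseteq> Mor A" and closed: "closed_under_coproducts A I S"
  shows "has_coproducts L I \<and> preserves_coproducts A L Q I"
proof -
  interpret A: category A by fact
  interpret L: category L by fact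
  have PA: "category (power_cat I A)" and PL: "category (power_cat I L)"
    using A L by (auto intro: category_power)
  have QI: "is_functor (power_cat I A) (power_cat I L) (power_functor I Q)"
    by (rule is_functor_power[OF Q])
  note Qhom = functorD(3)[OF Q, unfolded QO] and Qcomp = functorD(4)[OF Q]
  obtain K inc where K: "\<forall>X \<in> I \<rightarrow>\<^sub>E Obj A. is_coproduct A I X (K X) (inc X)"
    and KS: "\<forall>s \<in> I \<rightarrow>\<^sub>E S. coproduct_map A I (K (\<lambda>i\<in>I. Dom A (s i))) (inc (\<lambda>i\<in>I. Dom A (s i)))
      (K (\<lambda>i\<in>I. Cod A (s i))) (inc (\<lambda>i\<in>I. Cod A (s i))) s \<in> S"
    using closed unfolding closed_under_coproducts_def Let_def by blast
  have inc: "inc X i \<in> hom A (X i) (K X)" if "X \<in> I \<rightarrow>\<^sub>E Obj A" "i \<in> I" for X i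
    using is_coproductD(2) K that by metis
  have KO: "K X \<in> Obj A" if "X \<in> I \<rightarrow>\<^sub>E Obj A" for X using is_coproductD(1) K that by metis
  define cm where "cm f = coproduct_map A I (K (\<lambda>i\<in>I. Dom A (f i))) (inc (\<lambda>i\<in>I. Dom A (f i)))
      (K (\<lambda>i\<in>I. Cod A (f i))) (inc (\<lambda>i\<in>I. Cod A (f i))) f" for f
  have cm: "cm f \<in> hom A (K X) (K Y)" "\<forall>i\<in>I. Comp A (cm f) (inc X i) = Comp A (inc Y i) (f i)"
    and ends: "X \<in> I \<rightarrow>\<^sub>E Obj A" "Y \<in> I \<rightarrow>\<^sub>E Obj A" "\<forall>i\<in>I. f i \<in> hom A (X i) (Y i)"
    if "f \<in> hom (power_cat I A) X Y" for f X Y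
  proof -
    have XY: "X = (\<lambda>i\<in>I. Dom A (f i))" "Y = (\<lambda>i\<in>I. Cod A (f i))" "f \<in> I \<rightarrow>\<^sub>E Mor A"
      using that by (auto simp: hom_def)
    show O: "X \<in> I \<rightarrow>\<^sub>E Obj A" "Y \<in> I \<rightarrow>\<^sub>E Obj A" and f: "\<forall>i\<in>I. f i \<in> hom A (X i) (Y i)"
      using XY A.dom_obj A.cod_obj by (auto simp: PiE_iff hom_def)
    have "cm f = coproduct_map A I (K X) (inc X) (K Y) (inc Y) f" by (simp add: cm_def XY)
    then show "cm f \<in> hom A (K X) (K Y)"
      "\<forall>i\<in>I. Comp A (cm f) (inc X i) = Comp A (inc Y i) (f i)"
      using A.coproduct_map[OF K[rule_format, OF O(1)] K[rule_format, OF O(2)] f] by auto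
  qed
  have cm_eqI: "cm f = h" if "f \<in> hom (power_cat I A) X Y" "h \<in> hom A (K X) (K Y)"
    "\<And>i. i \<in> I \<Longrightarrow> Comp A h (inc X i) = Comp A (inc Y i) (f i)" for f h X Y
    by (rule A.coproduct_ext[OF K[rule_format, OF ends(1)[OF that(1)]] cm(1)[OF that(1)] that(2)])
      (use cm(2)[OF that(1)] that(3) in auto)
  define F where "F = \<lparr>FObj = K, FMor = (\<lambda>f. FMor Q (cm f))\<rparr>"
  have F: "is_functor (power_cat I A) L F"
    unfolding is_functor_def
  proof (intro conjI ballI impI)
    fix X assume X: "X \<in> Obj (power_cat I A)"
    then have X': "X \<in> I \<rightarrow>\<^sub>E Obj A" by simp
    show "FObj F X \<in> Obj L" using KO[OF X'] by (simp add: F_def OL)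
    have "cm (Idn (power_cat I A) X) = Idn A (K X)"
    proof (rule cm_eqI[OF category.idn_hom[OF PA X] A.idn_hom[OF KO[OF X']]])
      fix i assume i: "i \<in> I"
      show "Comp A (Idn A (K X)) (inc X i) = Comp A (inc X i) (Idn (power_cat I A) X i)"
        using A.idn_left[OF inc[OF X' i]] A.idn_right[OF inc[OF X' i]] i by simp
    qed
    then show "FMor F (Idn (power_cat I A) X) = Idn L (FObj F X)"
      using functorD(2)[OF Q KO[OF X']] QO by (simp add: F_def)
  next
    fix f assume "f \<in> Mor (power_cat I A)"
    then have "f \<in> hom (power_cat I A) (Dom (power_cat I A) f) (Cod (power_cat I A) f)"
      by (simp add: hom_def)
    from Qhom[OF cm(1)[OF this]]
    show "FMor F f \<in> hom L (FObj F (Dom (power_cat I A) f)) (FObj F (Cod (power_cat I A) f))"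
      by (simp add: F_def)
  next
    fix f g assume fg: "f \<in> Mor (power_cat I A)" "g \<in> Mor (power_cat I A)"
      "Cod (power_cat I A) f = Dom (power_cat I A) g"
    let ?X = "Dom (power_cat I A) f" and ?Y = "Cod (power_cat I A) f"
      and ?Z = "Cod (power_cat I A) g"
    have f: "f \<in> hom (power_cat I A) ?X ?Y" and g: "g \<in> hom (power_cat I A) ?Y ?Z"
      using fg by (auto simp: hom_def)
    note gf = category.comp_hom[OF PA f g]
    note ef = ends[OF f] and eg = ends[OF g] and cf = cm[OF f] and cg = cm[OF g]
    have "cm (Comp (power_cat I A) g f) = Comp A (cm g) (cm f)"
    proof (rule cm_eqI[OF gf A.comp_hom[OF cf(1) cg(1)]])
      fix i assume i: "i \<in> I"
      have "Comp A (Comp A (cm g) (cm f)) (inc ?X i) = Comp A (inc ?Z i) (Comp A (g i) (f i))"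
        by (rule A.square_comp[OF cf(1) cg(1) _ _ inc[OF ef(1) i] inc[OF ef(2) i]
              inc[OF eg(2) i]])
          (use ef(3) eg(3) cf(2) cg(2) i in \<open>auto simp del: power_simps\<close>)
      then show "Comp A (Comp A (cm g) (cm f)) (inc ?X i) =
          Comp A (inc ?Z i) (Comp (power_cat I A) g f i)" using i by simp
    qed
    then show "FMor F (Comp (power_cat I A) g f) = Comp L (FMor F g) (FMor F f)"
      using Qcomp[OF cf(1) cg(1)] by (simp add: F_def)
  qed
  have "is_iso L (FMor F s)" if "s \<in> I \<rightarrow>\<^sub>E S" for s
    using KS that inverts by (simp add: F_def cm_def)
  from extension[OF F this] obtain G where G: "is_functor (power_cat I L) L G"
    and GO: "\<And>X. FObj G X = K X"
    and GQ: "\<And>f. f \<in> I \<rightarrow>\<^sub>E Mor A \<Longrightarrow> FMor G (FMor (power_functor I Q) f) = FMor Q (cm f)"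
    by (auto simp: F_def)
  note Ghom = functorD(3)[OF G, unfolded GO] and Gcomp = functorD(4)[OF G]
  have ends_L: "X \<in> I \<rightarrow>\<^sub>E Obj A" "Y \<in> I \<rightarrow>\<^sub>E Obj A" "\<forall>i\<in>I. c i \<in> hom L (X i) (Y i)"
    if "c \<in> hom (power_cat I L) X Y" for c X Y
  proof -
    have XY: "X = (\<lambda>i\<in>I. Dom L (c i))" "Y = (\<lambda>i\<in>I. Cod L (c i))" "c \<in> I \<rightarrow>\<^sub>E Mor L"
      using that by (auto simp: hom_def)
    show "X \<in> I \<rightarrow>\<^sub>E Obj A" "Y \<in> I \<rightarrow>\<^sub>E Obj A" "\<forall>i\<in>I. c i \<in> hom L (X i) (Y i)"
      using XY L.dom_obj L.cod_obj OL by (auto simp: PiE_iff hom_def)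
  qed
  have Qinc: "FMor Q (inc X i) \<in> hom L (X i) (K X)" if "X \<in> I \<rightarrow>\<^sub>E Obj A" "i \<in> I" for X i
    using Qhom[OF inc[OF that]] .

  have QIhom: "FMor (power_functor I Q) f \<in> hom (power_cat I L) X Y"
    if "f \<in> hom (power_cat I A) X Y" for f X Y
  proof -
    have "FObj (power_functor I Q) Z = Z" if "Z \<in> I \<rightarrow>\<^sub>E Obj A" for Z
      using PiE_restrict[OF that] QO by (simp add: restrict_def)
    then show ?thesis using functorD(3)[OF QI that] ends(1,2)[OF that] by metis
  qed

  have inc_natural: "\<forall>i\<in>I. Comp L (FMor G c) (FMor Q (inc X i)) = Comp L (FMor Q (inc Y i)) (c i)"
    if "c \<in> hom (power_cat I L) X Y" for c X Y
  proof -
    have "fraction (power_cat I A) (I \<rightarrow>\<^sub>E S) (power_cat I L) (power_functor I Q) c"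
      by (rule power_generated) (use that in \<open>simp add: hom_def\<close>)
    then show ?thesis using that
    proof (induction arbitrary: X Y rule: fraction.induct)
      case (fraction_image f)
      let ?X = "Dom (power_cat I A) f" and ?Y = "Cod (power_cat I A) f"
      have f: "f \<in> hom (power_cat I A) ?X ?Y" using fraction_image.hyps by (simp add: hom_def)
      have XY: "?X = X" "?Y = Y"
        using homD[OF QIhom[OF f]] homD[OF fraction_image.prems] by metis+
      show ?case
      proof
        fix i assume i: "i \<in> I"
        have "Comp L (FMor Q (cm f)) (FMor Q (inc X i)) = FMor Q (Comp A (cm f) (inc X i))"
          using Qcomp inc cm(1)[OF f] ends[OF f] i XY by metis
        also have "\<dots> = FMor Q (Comp A (inc Y i) (f i))" using cm(2)[OF f] i XY by simp
        also have "\<dots> = Comp L (FMor Q (inc Y i)) (FMor Q (f i))"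
          using Qcomp inc ends[OF f] i XY by metis
        finally show "Comp L (FMor G (FMor (power_functor I Q) f)) (FMor Q (inc X i)) =
            Comp L (FMor Q (inc Y i)) (FMor (power_functor I Q) f i)"
          using GQ[of f] fraction_image.hyps i by simp
      qed
    next
      case (fraction_inverse s t)
      have "s \<in> Mor (power_cat I A)" using fraction_inverse.hyps SA by auto
      then have s: "s \<in> hom (power_cat I A) (Dom (power_cat I A) s) (Cod (power_cat I A) s)"
        by (simp add: hom_def)
      let ?Qs = "FMor (power_functor I Q) s"
      have Qs: "?Qs \<in> hom (power_cat I L) Y X"
        using fraction_inverse.hyps fraction_inverse.prems by (auto simp: inverse_mor_def hom_def)
      have XY: "Dom (power_cat I A) s = Y" "Cod (power_cat I A) s = X"
        using homD[OF QIhom[OF s]] homD[OF Qs] by metis+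
      note s = s[unfolded XY]
      have m: "s \<in> I \<rightarrow>\<^sub>E Mor A" using s by (simp add: hom_def)
      have Gs: "inverse_mor L (FMor Q (cm s)) (FMor G t)"
        using functor_inverse[OF G PL fraction_inverse.hyps(2)] GQ[OF m] by simp
      have ts: "inverse_mor L (FMor Q (s i)) (t i)" if "i \<in> I" for i
      proof -
        have "?Qs \<in> I \<rightarrow>\<^sub>E Mor L" "t \<in> extensional I"
          using Qs fraction_inverse.prems by (auto simp: hom_def PiE_def)
        from inverse_mor_power[OF this] show ?thesis using fraction_inverse.hyps(2) that by simp
      qed
      show ?case
      proof
        fix i assume i: "i \<in> I"
        show "Comp L (FMor G t) (FMor Q (inc X i)) = Comp L (FMor Q (inc Y i)) (t i)"
        proof (rule L.square_inverse[OF Qhom[OF cm(1)[OF s]] Gs _ ts[OF i]])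
          show "FMor Q (s i) \<in> hom L (Y i) (X i)" using Qhom ends(3)[OF s] i by blast
          show "FMor Q (inc Y i) \<in> hom L (Y i) (K Y)" "FMor Q (inc X i) \<in> hom L (X i) (K X)"
            using Qinc ends[OF s] i by auto
          show "Comp L (FMor Q (cm s)) (FMor Q (inc Y i)) = Comp L (FMor Q (inc X i)) (FMor Q (s i))"
            using Qcomp inc cm[OF s] ends[OF s] i by metis
        qed
      qed
    next
      case (fraction_comp c d)
      let ?Z = "Cod (power_cat I L) c"
      have XY: "X = Dom (power_cat I L) c" "Y = Cod (power_cat I L) d"
        using category.comp_mor[OF PL fraction_comp.hyps(3-5)] fraction_comp.prems
        unfolding hom_def by blast+
      have c: "c \<in> hom (power_cat I L) X ?Z" and d: "d \<in> hom (power_cat I L) ?Z Y"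
        using fraction_comp.hyps XY unfolding hom_def by auto
      note ec = ends_L[OF c] and ed = ends_L[OF d]
      show ?case
      proof
        fix i assume i: "i \<in> I"
        have "Comp L (Comp L (FMor G d) (FMor G c)) (FMor Q (inc X i)) =
            Comp L (FMor Q (inc Y i)) (Comp L (d i) (c i))"
          by (rule L.square_comp[OF Ghom[OF c] Ghom[OF d] _ _ Qinc[OF ec(1) i] Qinc[OF ec(2) i]
                Qinc[OF ed(2) i]])
            (use ec(3) ed(3) fraction_comp.IH(1)[OF c] fraction_comp.IH(2)[OF d] i in blast)+
        then show "Comp L (FMor G (Comp (power_cat I L) d c)) (FMor Q (inc X i)) =
            Comp L (FMor Q (inc Y i)) (Comp (power_cat I L) d c i)"
          using Gcomp[OF c d] i by simp
      qed
    qed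
  qed

  have const_obj: "(\<lambda>i\<in>I. Z) \<in> I \<rightarrow>\<^sub>E Obj A" if "Z \<in> Obj A" for Z
    using that by auto
  have const_A: "(\<lambda>i\<in>I. f) \<in> hom (power_cat I A) (\<lambda>i\<in>I. X) (\<lambda>i\<in>I. Y)"
    if "f \<in> hom A X Y" for f X Y using that by (auto simp: hom_def restrict_eq_iff)
  have const_L: "(\<lambda>i\<in>I. c) \<in> hom (power_cat I L) (\<lambda>i\<in>I. X) (\<lambda>i\<in>I. Y)"
    if "c \<in> hom L X Y" for c X Y using that by (auto simp: hom_def restrict_eq_iff)
  have "\<exists>h. h \<in> hom A (K (\<lambda>i\<in>I. Z)) Z \<and> (\<forall>i\<in>I. Comp A h (inc (\<lambda>i\<in>I. Z) i) = Idn A Z)"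
    if "Z \<in> Obj A" for Z
    using is_coproductD(4)[OF K[rule_format, OF const_obj[OF that]] that, of "\<lambda>i. Idn A Z"]
      A.idn_hom[OF that] by auto
  then obtain codiag where codiag: "\<And>Z. Z \<in> Obj A \<Longrightarrow> codiag Z \<in> hom A (K (\<lambda>i\<in>I. Z)) Z"
    and codiag_inc: "\<And>Z i. Z \<in> Obj A \<Longrightarrow> i \<in> I \<Longrightarrow>
      Comp A (codiag Z) (inc (\<lambda>i\<in>I. Z) i) = Idn A Z" by metis
  note inc_const = inc[OF const_obj]
  have Qcodiag: "FMor Q (codiag Z) \<in> hom L (K (\<lambda>i\<in>I. Z)) Z" if "Z \<in> Obj A" for Z
    using Qhom[OF codiag[OF that]] .

  have codiag_natural_A: "Comp L (FMor Q f) (FMor Q (codiag X)) =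
      Comp L (FMor Q (codiag Y)) (FMor G (\<lambda>i\<in>I. FMor Q f))" if f: "f \<in> hom A X Y" for f X Y
  proof -
    have O: "X \<in> Obj A" "Y \<in> Obj A" using A.hom_obj[OF f] by auto
    note cf = cm[OF const_A[OF f]]
    have "Comp A f (codiag X) = Comp A (codiag Y) (cm (\<lambda>i\<in>I. f))"
    proof (rule A.coproduct_ext[OF K[rule_format, OF const_obj[OF O(1)]]
          A.comp_hom[OF codiag[OF O(1)] f] A.comp_hom[OF cf(1) codiag[OF O(2)]]], rule ballI)
      fix i assume i: "i \<in> I"
      have iX: "inc (\<lambda>i\<in>I. X) i \<in> hom A X (K (\<lambda>i\<in>I. X))"
        and iY: "inc (\<lambda>i\<in>I. Y) i \<in> hom A Y (K (\<lambda>i\<in>I. Y))"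
        using inc_const[OF O(1) i] inc_const[OF O(2) i] i by auto
      have "Comp A (Comp A f (codiag X)) (inc (\<lambda>i\<in>I. X) i) = f"
        using A.comp_assoc[OF iX codiag[OF O(1)] f] codiag_inc[OF O(1) i] A.idn_right[OF f] by simp
      moreover have "Comp A (Comp A (codiag Y) (cm (\<lambda>i\<in>I. f))) (inc (\<lambda>i\<in>I. X) i) =
          Comp A (codiag Y) (Comp A (inc (\<lambda>i\<in>I. Y) i) f)"
        using A.comp_assoc[OF iX cf(1) codiag[OF O(2)]] cf(2) i by simp
      moreover have "\<dots> = f"
        using A.comp_assoc[OF f iY codiag[OF O(2)]] codiag_inc[OF O(2) i] A.idn_left[OF f] by simp
      ultimately show "Comp A (Comp A f (codiag X)) (inc (\<lambda>i\<in>I. X) i) =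
          Comp A (Comp A (codiag Y) (cm (\<lambda>i\<in>I. f))) (inc (\<lambda>i\<in>I. X) i)" by simp
    qed
    then have "Comp L (FMor Q f) (FMor Q (codiag X)) =
        Comp L (FMor Q (codiag Y)) (FMor Q (cm (\<lambda>i\<in>I. f)))"
      using Qcomp[OF codiag[OF O(1)] f] Qcomp[OF cf(1) codiag[OF O(2)]] by simp
    moreover have "FMor G (\<lambda>i\<in>I. FMor Q f) = FMor Q (cm (\<lambda>i\<in>I. f))"
      using GQ[of "\<lambda>i\<in>I. f"] f by (simp add: hom_def cong: restrict_cong)
    ultimately show ?thesis by metis
  qed

  \<comment> \<open>This needs generation of \<open>L\<close> itself: for empty \<open>I\<close>, a constant family says nothing
    about the morphism \<open>c\<close>.\<close>
  have codiag_natural: "Comp L c (FMor Q (codiag X)) = Comp L (FMor Q (codiag Y)) (FMor G (\<lambda>i\<in>I. c))"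
    if "c \<in> hom L X Y" for c X Y
  proof -
    have "fraction A S L Q c" by (rule generated) (use that in \<open>simp add: hom_def\<close>)
    then show ?thesis using that
    proof (induction arbitrary: X Y rule: fraction.induct)
      case (fraction_image f)
      have f: "f \<in> hom A (Dom A f) (Cod A f)" using fraction_image by (simp add: hom_def)
      then have XY: "Dom A f = X" "Cod A f = Y"
        using homD[OF Qhom[OF f]] homD[OF fraction_image.prems] by metis+
      show ?case by (rule codiag_natural_A[OF f[unfolded XY]])
    next
      case (fraction_inverse s t)
      have s: "s \<in> hom A (Dom A s) (Cod A s)"
        using fraction_inverse.hyps SA by (auto simp: hom_def)
      note Qs = Qhom[OF s]
      have XY: "Dom A s = Y" "Cod A s = X"
        using fraction_inverse.hyps homD[OF Qs] homD[OF fraction_inverse.prems]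
        by (auto simp: inverse_mor_def dest!: homD)
      note Qs = Qs[unfolded XY]
      have O: "X \<in> Obj A" "Y \<in> Obj A" using L.hom_obj[OF Qs] OL by auto
      have "inverse_mor (power_cat I L) (\<lambda>i\<in>I. FMor Q s) (\<lambda>i\<in>I. t)"
        using fraction_inverse.hyps Qs by (subst inverse_mor_power) (auto simp: hom_def)
      note Gs = functor_inverse[OF G PL this]
      show ?case
        by (rule L.square_inverse[OF Qs fraction_inverse.hyps(2) Ghom[OF const_L[OF Qs]] Gs
              Qcodiag[OF O(2)] Qcodiag[OF O(1)] codiag_natural_A[OF s[unfolded XY]]])
    next
      case (fraction_comp c d)
      let ?Z = "Cod L c"
      have XY: "X = Dom L c" "Y = Cod L d"
        using L.comp_mor[OF fraction_comp.hyps(3-5)] homD[OF fraction_comp.prems] by auto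
      have c: "c \<in> hom L X ?Z" and d: "d \<in> hom L ?Z Y"
        using fraction_comp.hyps XY by (auto simp: hom_def)
      have O: "X \<in> Obj A" "?Z \<in> Obj A" "Y \<in> Obj A"
        using L.hom_obj[OF c] L.hom_obj[OF d] OL by auto
      have "Comp (power_cat I L) (\<lambda>i\<in>I. d) (\<lambda>i\<in>I. c) = (\<lambda>i\<in>I. Comp L d c)"
        by (auto simp: restrict_eq_iff)
      then have "FMor G (\<lambda>i\<in>I. Comp L d c) = Comp L (FMor G (\<lambda>i\<in>I. d)) (FMor G (\<lambda>i\<in>I. c))"
        using Gcomp[OF const_L[OF c] const_L[OF d]] by metis
      then show ?case
        using L.square_comp[OF c d Ghom[OF const_L[OF c]] Ghom[OF const_L[OF d]]
            Qcodiag[OF O(1)] Qcodiag[OF O(2)] Qcodiag[OF O(3)]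
            fraction_comp.IH(1)[OF c] fraction_comp.IH(2)[OF d]] by metis
    qed
  qed

  have coproduct: "is_coproduct L I X (K X) (\<lambda>i. FMor Q (inc X i))" if X: "X \<in> I \<rightarrow>\<^sub>E Obj A" for X
    unfolding is_coproduct_def
  proof (intro conjI ballI allI impI)
    show "K X \<in> Obj L" using KO[OF X] OL by simp
    show "X i \<in> Obj L" if "i \<in> I" for i using X OL that by auto
    show "FMor Q (inc X i) \<in> hom L (X i) (K X)" if "i \<in> I" for i by (rule Qinc[OF X that])
    fix Z f assume Z': "Z \<in> Obj L" and f: "\<forall>i\<in>I. f i \<in> hom L (X i) Z"
    have Z: "Z \<in> Obj A" using Z' OL by simp
    let ?c = "\<lambda>i\<in>I. f i" and ?Z = "\<lambda>i\<in>I. Z"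
    have c: "?c \<in> hom (power_cat I L) X ?Z"
      unfolding hom_power[OF X const_obj[OF Z]] using f by simp
    define h where "h = Comp L (FMor Q (codiag Z)) (FMor G ?c)"
    show "\<exists>!h. h \<in> hom L (K X) Z \<and> (\<forall>i\<in>I. Comp L h (FMor Q (inc X i)) = f i)"
    proof (intro ex1I[of _ h] conjI ballI)
      show "h \<in> hom L (K X) Z" unfolding h_def by (rule L.comp_hom[OF Ghom[OF c] Qcodiag[OF Z]])
      fix i assume i: "i \<in> I"
      have iZ: "inc ?Z i \<in> hom A Z (K ?Z)" and fi: "f i \<in> hom L (X i) Z"
        using inc_const[OF Z i] f i by auto
      have "Comp L h (FMor Q (inc X i)) =
          Comp L (FMor Q (codiag Z)) (Comp L (FMor Q (inc ?Z i)) (f i))"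
        unfolding h_def L.comp_assoc[OF Qinc[OF X i] Ghom[OF c] Qcodiag[OF Z]]
        using inc_natural[OF c] i by simp
      also have "\<dots> = Comp L (FMor Q (Comp A (codiag Z) (inc ?Z i))) (f i)"
        using L.comp_assoc[OF fi Qhom[OF iZ] Qcodiag[OF Z]] Qcomp[OF iZ codiag[OF Z]] by simp
      also have "\<dots> = f i"
        using codiag_inc[OF Z i] functorD(2)[OF Q Z] QO L.idn_left[OF fi] by simp
      finally show "Comp L h (FMor Q (inc X i)) = f i" .
    next
      fix h' assume h': "h' \<in> hom L (K X) Z \<and> (\<forall>i\<in>I. Comp L h' (FMor Q (inc X i)) = f i)"
      then have h'L: "h' \<in> hom L (K X) Z" by blast
      \<comment> \<open>The family \<open>f\<close> is \<open>h'\<close> at all indices after the inclusions; applying \<open>G\<close> and the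
        codiagonal gives back \<open>h'\<close>.\<close>
      let ?K = "\<lambda>i\<in>I. K X" and ?inc = "\<lambda>i\<in>I. inc X i"
      have j: "?inc \<in> hom (power_cat I A) X ?K"
        unfolding hom_power[OF X const_obj[OF KO[OF X]]] using inc[OF X] by simp
      have jm: "?inc \<in> I \<rightarrow>\<^sub>E Mor A" using j by (simp add: hom_def)
      have "?c = Comp (power_cat I L) (\<lambda>i\<in>I. h') (FMor (power_functor I Q) ?inc)"
        using h' by (auto simp: restrict_eq_iff)
      then have Gc: "FMor G ?c = Comp L (FMor G (\<lambda>i\<in>I. h')) (FMor Q (cm ?inc))"
        using Gcomp[OF QIhom[OF j] const_L[OF h'L]] GQ[OF jm] by metis
      have "Comp A (codiag (K X)) (cm ?inc) = Idn A (K X)"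
      proof (rule A.coproduct_ext[OF K[rule_format, OF X]
            A.comp_hom[OF cm(1)[OF j] codiag[OF KO[OF X]]] A.idn_hom[OF KO[OF X]]], rule ballI)
        fix i assume i: "i \<in> I"
        have iK: "inc ?K i \<in> hom A (K X) (K ?K)" using inc_const[OF KO[OF X] i] i by simp
        have "Comp A (Comp A (codiag (K X)) (cm ?inc)) (inc X i) =
            Comp A (codiag (K X)) (Comp A (inc ?K i) (inc X i))"
          using A.comp_assoc[OF inc[OF X i] cm(1)[OF j] codiag[OF KO[OF X]]] cm(2)[OF j] i by simp
        also have "\<dots> = Comp A (Idn A (K X)) (inc X i)"
          using A.comp_assoc[OF inc[OF X i] iK codiag[OF KO[OF X]]] codiag_inc[OF KO[OF X] i] by simp
        finally show "Comp A (Comp A (codiag (K X)) (cm ?inc)) (inc X i) =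
            Comp A (Idn A (K X)) (inc X i)" .
      qed
      then have id: "Comp L (FMor Q (codiag (K X))) (FMor Q (cm ?inc)) = Idn L (K X)"
        using Qcomp[OF cm(1)[OF j] codiag[OF KO[OF X]]] functorD(2)[OF Q KO[OF X]] QO by simp
      have "h = Comp L (Comp L (FMor Q (codiag Z)) (FMor G (\<lambda>i\<in>I. h'))) (FMor Q (cm ?inc))"
        unfolding h_def Gc
        by (rule L.comp_assoc[OF Qhom[OF cm(1)[OF j]] Ghom[OF const_L[OF h'L]] Qcodiag[OF Z],
              symmetric])
      also have "\<dots> = Comp L (Comp L h' (FMor Q (codiag (K X)))) (FMor Q (cm ?inc))"
        using codiag_natural[OF h'L] by simp
      also have "\<dots> = h'"
        using L.comp_assoc[OF Qhom[OF cm(1)[OF j]] Qcodiag[OF KO[OF X]] h'L] id L.idn_right[OF h'L]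
        by simp
      finally show "h' = h" by simp
    qed
  qed

  have "\<exists>K inc. is_coproduct L I X K inc" if "X \<in> I \<rightarrow> Obj L" for X
  proof -
    have X: "restrict X I \<in> I \<rightarrow>\<^sub>E Obj A" using that OL by auto
    have "is_coproduct L I X (K (restrict X I)) (\<lambda>i. FMor Q (inc (restrict X I) i))"
      using coproduct[OF X] is_coproduct_cong[of I "restrict X I" X] by auto
    then show ?thesis by blast
  qed
  moreover have "is_coproduct L I (FObj Q \<circ> X) (FObj Q K') (FMor Q \<circ> inc')"
    if K': "is_coproduct A I X K' inc'" for X K' inc'
  proof -
    let ?X = "restrict X I"
    have X: "?X \<in> I \<rightarrow>\<^sub>E Obj A" using is_coproductD(3)[OF K'] by auto
    have "is_coproduct A I ?X K' inc'" using K' is_coproduct_cong[of I "?X" X] by auto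
    from A.coproduct_unique[OF K[rule_format, OF X] this] obtain f g
      where f: "f \<in> hom A (K ?X) K'" "inverse_mor A f g" "\<forall>i\<in>I. Comp A f (inc ?X i) = inc' i" .
    have K'': "is_coproduct L I ?X K' (\<lambda>i. Comp L (FMor Q f) (FMor Q (inc ?X i)))"
      by (rule L.coproduct_transfer[OF coproduct[OF X] Qhom[OF f(1)] functor_inverse[OF Q A f(2)]])
    have "\<forall>i\<in>I. Comp L (FMor Q f) (FMor Q (inc ?X i)) = (FMor Q \<circ> inc') i"
      using Qcomp[OF inc[OF X] f(1)] f(3) by auto
    moreover have "\<forall>i\<in>I. ?X i = (FObj Q \<circ> X) i" using QO by simp
    ultimately have "is_coproduct L I (FObj Q \<circ> X) K' (FMor Q \<circ> inc')"
      using is_coproduct_cong[THEN iffD1, OF _ _ K''] by blast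
    then show ?thesis using QO by simp
  qed
  ultimately show ?thesis unfolding has_coproducts_def preserves_coproducts_def by blast
qed

section \<open>Uniform bounds on rewriting distances\<close>

context localizing
begin

lemma rewritings_sym: "(P, R) \<in> rewriting A S ^^ m \<Longrightarrow> (R, P) \<in> rewriting A S ^^ m"
proof (induction m arbitrary: R)
  case (Suc m)
  then obtain z where "(P, z) \<in> rewriting A S ^^ m" "(z, R) \<in> rewriting A S" by auto
  then show ?case using Suc.IH rewriting_sym relpow_Suc_I2 by metis
qed simp

lemma rewritings_class:
  assumes "(P, R) \<in> rewriting A S ^^ m" "P \<in> words A S"
  shows "R \<in> words A S \<and> word_class A S R = word_class A S P"
  using assms
proof (induction m arbitrary: R)
  case (Suc m)
  then obtain z where "(P, z) \<in> rewriting A S ^^ m" "(z, R) \<in> rewriting A S" by auto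
  then show ?case using Suc rewriting_class rewriting_words by metis
qed simp

lemma rewritings_cons:
  assumes "(P, R) \<in> rewriting A S ^^ m" "P \<in> words A S" "a # P \<in> words A S"
  shows "(a # P, a # R) \<in> rewriting A S ^^ m \<and> a # R \<in> words A S"
  using assms(1)
proof (induction m arbitrary: R)
  case (Suc m)
  then obtain z where z: "(P, z) \<in> rewriting A S ^^ m" "(z, R) \<in> rewriting A S" by auto
  have IH: "(a # P, a # z) \<in> rewriting A S ^^ m" "a # z \<in> words A S" using Suc.IH[OF z(1)] by auto
  have "z \<noteq> []" using rewriting_words[OF z(2)] by (auto simp: words_def)
  then have "([a] @ z, [a] @ R) \<in> rewriting A S"
    using words_append[of "[a]" z A S] IH(2) by (intro rewriting_append_left[OF z(2)]) auto
  then show ?case using IH rewriting_words by auto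
qed (use assms in simp)

text \<open>Induction from the source of the word: once the tail has at most \<open>n\<close> letters, adding the next letter
  gives a word of length at most \<open>n + 1\<close>, which can be shortened within \<open>d\<close> steps.\<close>

lemma rewritings_to_short_word:
  assumes short: "\<forall>P \<in> words A S. \<exists>R \<in> words A S. word_class A S R = word_class A S P \<and> length R \<le> n"
    and near: "\<forall>P \<in> words A S. \<forall>R \<in> words A S. length P \<le> Suc n \<longrightarrow> length R \<le> Suc n \<longrightarrow>
      word_class A S P = word_class A S R \<longrightarrow> (\<exists>m\<le>d. (P, R) \<in> rewriting A S ^^ m)"
    and P: "P \<in> words A S"
  shows "\<exists>R \<in> words A S. length R \<le> n \<and> (\<exists>m \<le> d * length P. (P, R) \<in> rewriting A S ^^ m)"
  using P
proof (induction P)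
  case (Cons a P)
  have step: "\<exists>R' \<in> words A S. length R' \<le> n \<and> (\<exists>m\<le>d. (R, R') \<in> rewriting A S ^^ m)"
    if R: "R \<in> words A S" "length R \<le> Suc n" for R
  proof -
    obtain R' where "R' \<in> words A S" "word_class A S R' = word_class A S R" "length R' \<le> n"
      using short R by blast
    then show ?thesis using near R by (metis le_SucI)
  qed
  show ?case
  proof (cases "P = []")
    case True
    then show ?thesis using step[of "[a]"] Cons.prems by simp
  next
    case False
    then have P: "P \<in> words A S" using words_append[of "[a]" P A S] Cons.prems by auto
    then obtain R m where R: "R \<in> words A S" "length R \<le> n" "m \<le> d * length P"
      "(P, R) \<in> rewriting A S ^^ m" using Cons.IH by blast
    note aR = rewritings_cons[OF R(4) P Cons.prems]
    then obtain R' m' where R': "R' \<in> words A S" "length R' \<le> n" "m' \<le> d"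
      "(a # R, R') \<in> rewriting A S ^^ m'" using step[of "a # R"] R by auto
    have "(a # P, R') \<in> rewriting A S ^^ (m + m')" using aR R'(4) by (auto simp: relpow_add)
    moreover have "m + m' \<le> d * length (a # P)" using R(3) R'(3) by simp
    ultimately show ?thesis using R' by blast
  qed
qed (simp add: words_def)

lemma uniform_rewriting_distance:
  assumes short: "\<forall>P \<in> words A S. \<exists>R \<in> words A S. word_class A S R = word_class A S P \<and> length R \<le> n"
    and near: "\<forall>P \<in> words A S. \<forall>R \<in> words A S. length P \<le> Suc n \<longrightarrow> length R \<le> Suc n \<longrightarrow>
      word_class A S P = word_class A S R \<longrightarrow> (\<exists>m\<le>d. (P, R) \<in> rewriting A S ^^ m)"
  shows "\<exists>M. \<forall>P \<in> words A S. \<forall>R \<in> words A S. length P \<le> k \<longrightarrow> length R \<le> k \<longrightarrow>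
      word_class A S P = word_class A S R \<longrightarrow> (\<exists>m\<le>M. (P, R) \<in> rewriting A S ^^ m)"
proof (rule exI[of _ "d * k + d + d * k"], intro ballI impI)
  fix P R assume PR: "P \<in> words A S" "R \<in> words A S" "length P \<le> k" "length R \<le> k"
    and eq: "word_class A S P = word_class A S R"
  obtain P' m where P': "P' \<in> words A S" "length P' \<le> n" "m \<le> d * length P"
    "(P, P') \<in> rewriting A S ^^ m" using rewritings_to_short_word[OF short near PR(1)] by blast
  obtain R' m' where R': "R' \<in> words A S" "length R' \<le> n" "m' \<le> d * length R"
    "(R, R') \<in> rewriting A S ^^ m'" using rewritings_to_short_word[OF short near PR(2)] by blast
  have "word_class A S P' = word_class A S R'"
    using rewritings_class[OF P'(4) PR(1)] rewritings_class[OF R'(4) PR(2)] eq by simp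
  then obtain l where l: "l \<le> d" "(P', R') \<in> rewriting A S ^^ l"
    using near[rule_format, of P' R'] P'(1,2) R'(1,2) by auto
  have "(P, R) \<in> rewriting A S ^^ (m + l + m')"
    using P'(4) l(2) rewritings_sym[OF R'(4)] by (auto simp: relpow_add)
  moreover have "m \<le> d * k" "m' \<le> d * k"
    using P'(3) R'(3) PR(3,4) by (meson le_trans mult_le_mono2)+
  ultimately show "\<exists>m \<le> d * k + d + d * k. (P, R) \<in> rewriting A S ^^ m"
    using l(1) by (intro exI[of _ "m + l + m'"]) simp
qed

lemma word_length_attained:
  assumes "P \<in> words A S"
  shows "\<exists>R \<in> words A S. word_class A S R = word_class A S P \<and> length R = word_length A S P"
  unfolding word_length_def by (rule LeastI) (use assms in blast)

lemma rewriting_dist_attained: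
  assumes "P \<in> words A S" "R \<in> words A S" "word_class A S P = word_class A S R"
  shows "(P, R) \<in> rewriting A S ^^ rewriting_dist A S P R"
proof -
  have "(P, R) \<in> (rewriting A S)\<^sup>*"
    using assms word_class_eq_iff[OF assms(1,2)] by (auto simp: word_equiv_def)
  then obtain n where "(P, R) \<in> rewriting A S ^^ n" by (auto simp: rtrancl_power)
  then show ?thesis unfolding rewriting_dist_def by (rule LeastI)
qed

end

section \<open>Coproducts and products in the localization\<close>

theorem theorem5p6:
  fixes A :: "('o, 'm) cat" and S :: "'m set" and I :: "'i set" and N :: enat
  assumes "category A"
    and "S \<subseteq> Mor A"
    and "\<forall>X \<in> Obj A. Idn A X \<in> S"
    and "N = Sup {enat (word_length A S P) | P. P \<in> words A S}"
    and "N < \<infinity>"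
    and "Sup {enat (rewriting_dist A S P Q) | P Q.
           P \<in> words A S \<and> Q \<in> words A S \<and> word_class A S P = word_class A S Q \<and>
           enat (length P) \<le> N + 1 \<and> enat (length Q) \<le> N + 1} < \<infinity>"
  shows "(has_coproducts A I \<and> closed_under_coproducts A I S \<longrightarrow>
           has_coproducts (localization A S) I \<and>
           preserves_coproducts A (localization A S) (localization_functor A S) I) \<and>
         (has_products A I \<and> closed_under_products A I S \<longrightarrow>
           has_products (localization A S) I \<and>
           preserves_products A (localization A S) (localization_functor A S) I)"
proof -
  interpret localizing_with_identities A S
    using assms(1-3)
    by (simp add: localizing_with_identities_def localizing_with_identities_axioms_def
        localizing_def localizing_axioms_def)
  obtain n where n: "N = enat n" using assms(5) by auto
  obtain d where d: "Sup {enat (rewriting_dist A S P Q) | P Q.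
           P \<in> words A S \<and> Q \<in> words A S \<and> word_class A S P = word_class A S Q \<and>
           enat (length P) \<le> N + 1 \<and> enat (length Q) \<le> N + 1} = enat d"
    by (rule less_infinityE[OF assms(6)])
  have short: "\<forall>P \<in> words A S. \<exists>R \<in> words A S. word_class A S R = word_class A S P \<and> length R \<le> n"
  proof
    fix P assume P: "P \<in> words A S"
    have "enat (word_length A S P) \<le> N" unfolding assms(4) by (rule Sup_upper) (use P in blast)
    then show "\<exists>R \<in> words A S. word_class A S R = word_class A S P \<and> length R \<le> n"
      using word_length_attained[OF P] n by auto
  qed
  have near: "\<forall>P \<in> words A S. \<forall>R \<in> words A S. length P \<le> Suc n \<longrightarrow> length R \<le> Suc n \<longrightarrow>
      word_class A S P = word_class A S R \<longrightarrow> (\<exists>m\<le>d. (P, R) \<in> rewriting A S ^^ m)"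
  proof (intro ballI impI)
    fix P R assume PR: "P \<in> words A S" "R \<in> words A S" "length P \<le> Suc n" "length R \<le> Suc n"
      "word_class A S P = word_class A S R"
    have "N + 1 = enat (Suc n)" using n by (simp add: one_enat_def)
    then have "enat (rewriting_dist A S P R) \<le> enat d"
      unfolding d[symmetric] by (intro Sup_upper) (use PR in auto)
    then show "\<exists>m\<le>d. (P, R) \<in> rewriting A S ^^ m"
      using rewriting_dist_attained[OF PR(1,2,5)] by auto
  qed
  interpret bounded_localizing A S n
    using short uniform_rewriting_distance[OF short near] by unfold_locales blast+
  have Q: "is_functor A L Q" by (rule localization_functor_functor)
  have QO: "FObj Q X = X" for X by (simp add: localization_functor_def)
  have ext: "\<exists>G. is_functor (power_cat I L) D G \<and> (\<forall>X. FObj G X = FObj F X) \<and>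
      (\<forall>f \<in> I \<rightarrow>\<^sub>E Mor A. FMor G (FMor (power_functor I Q) f) = FMor F f)"
    if "category D" "is_functor (power_cat I A) D F" "\<And>s. s \<in> I \<rightarrow>\<^sub>E S \<Longrightarrow> is_iso D (FMor F s)"
    for D :: "('o, 'm arrow list set) cat" and F
    using functor_extends_along_power[OF that] by metis
  have coproducts: "has_coproducts L I \<and> preserves_coproducts A L Q I"
    if "closed_under_coproducts A I S"
    by (rule coproducts_of_power_localization[OF assms(1) localization_category Q QO loc_obj
          localization_functor_inverts localization_fraction power_localization_fraction
          ext[OF localization_category] assms(2) that])
  have products: "has_products L I \<and> preserves_products A L Q I"
    if "closed_under_products A I S"
  proof -
    have "has_coproducts (opposite L) I \<and> preserves_coproducts (opposite A) (opposite L) Q I"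
    proof (rule coproducts_of_power_localization[where S = S])
      show "fraction (opposite A) S (opposite L) Q c" if "c \<in> Mor (opposite L)" for c
        using fraction_opposite[OF localization_fraction] that by simp
      show "fraction (power_cat I (opposite A)) (I \<rightarrow>\<^sub>E S) (power_cat I (opposite L))
          (power_functor I Q) c" if "c \<in> Mor (power_cat I (opposite L))" for c
        using fraction_opposite[OF power_localization_fraction] that
        by (simp add: opposite_power)
      show "\<exists>G. is_functor (power_cat I (opposite L)) (opposite L) G \<and> (\<forall>X. FObj G X = FObj F X) \<and>
          (\<forall>f \<in> I \<rightarrow>\<^sub>E Mor (opposite A). FMor G (FMor (power_functor I Q) f) = FMor F f)"
        if "is_functor (power_cat I (opposite A)) (opposite L) F"
          "\<And>s. s \<in> I \<rightarrow>\<^sub>E S \<Longrightarrow> is_iso (opposite L) (FMor F s)" for F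
        using ext[OF localization_category, of F] that
        by (simp add: opposite_power[symmetric])
    qed (use assms(1,2) that Q QO localization_category localization_functor_inverts in
        \<open>simp_all add: category_opposite loc_obj\<close>)
    then show ?thesis by simp
  qed
  show ?thesis using coproducts products by blast
qed

end
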